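(* Let $m\geq 2$ and let $p(S_1,\ldots,S_n):=\sum_{|\alpha|\leq m-1}a_\alpha S_\alpha$, $a_\alpha\in\mathbb{C}$, be a polynomial such that $p(0)\geq 0$ and $\mathrm{Re}\,p(S_1,\ldots,S_n)\leq I$. Then $$\sum_{k=0}^{m-1}\left\|\sum_{|\alpha|=k}|a_\alpha|T_\alpha\right\|\leq 1$$ for every Hilbert space $\mathcal{K}$ and every $(T_1,\ldots,T_n)\in[B(\mathcal{K})^n]_{t_m}$, where $t_m\in(0,1]$ is the positive solution of the equation $$\sum_{k=1}^{m-1}t^k\cos\frac{\pi}{\left[\frac{m-1}{k}\right]+2}=\frac12,$$ $[x]$ denoting the integer part of $x$. Moreover, $\{t_m\}_{m\ge 2}$ is a strictly decreasing sequence which converges to $\frac13$. In particular, $$\sum_{|\alpha|\leq m-1}|a_\alpha|r_\alpha\leq 1$$ for any $r:=(r_1,\ldots,r_n)$ with $r_1\geq0,\ldots,r_n\geq0$ and $\|r\|_2\leq t_m$.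
   Context: Let $n\ge 1$ and let $H_n$ be an $n$-dimensional complex Hilbert space with orthonormal basis $e_1,\dots,e_n$. The full Fock space is $F^2(H_n)=\bigoplus_{k\ge0}H_n^{\otimes k}$ with $H_n^{\otimes0}=\mathbb{C}1$. The left creation operators $S_1,\dots,S_n$ on $F^2(H_n)$ are $S_i\varphi=e_i\otimes\varphi$. $\mathbb{F}_n^+$ is the unital free semigroup on generators $g_1,\dots,g_n$ with identity $g_0$; the length is $|g_{i_1}\cdots g_{i_k}|=k$, $|g_0|=0$. For operators $T_1,\dots,T_n$ and $\alpha=g_{i_1}\cdots g_{i_k}$, $T_\alpha:=T_{i_1}\cdots T_{i_k}$ and $T_{g_0}:=I$; for scalars, likewise $r_\alpha:=r_{i_1}\cdots r_{i_k}$, $r_{g_0}:=1$. Sums are over $\alpha\in\mathbb{F}_n^+$. $p(0)=a_{g_0}$ is the constant coefficient; $\mathrm{Re}\,A=\frac12(A+A^* )$. For $r\ge0$, $[B(\mathcal{K})^n]_r:=\{(T_1,\ldots,T_n)\in B(\mathcal{K})^n:\|T_1T_1^*+\cdots+T_nT_n^*\|^{1/2}\le r\}$. $\|\cdot\|_2$ is the Euclidean norm. *)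

theory Defs
  imports "HOL-Analysis.Analysis"
begin

section \<open>Complex Hilbert spaces\<close>

class scaleC =
  fixes scaleC :: "complex \<Rightarrow> 'a \<Rightarrow> 'a"  (infixr \<open>*\<^sub>C\<close> 75)

text \<open>
  A complex inner product space is a real one (with real inner product the real part of the
  complex one), so that norm, topology, bounded operators and the operator norm are those of
  HOL-Analysis. The complex inner product is linear in the first argument.
\<close>

class complex_inner = real_inner + scaleC +
  fixes cinner :: "'a \<Rightarrow> 'a \<Rightarrow> complex"
  assumes scaleC_add_right: "a *\<^sub>C (x + y) = a *\<^sub>C x + a *\<^sub>C y"
    and scaleC_add_left: "(a + b) *\<^sub>C x = a *\<^sub>C x + b *\<^sub>C x"
    and scaleC_scaleC: "a *\<^sub>C b *\<^sub>C x = (a * b) *\<^sub>C x"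
    and scaleC_of_real: "complex_of_real r *\<^sub>C x = r *\<^sub>R x"
    and cinner_commute: "cinner x y = cnj (cinner y x)"
    and cinner_add_left: "cinner (x + y) z = cinner x z + cinner y z"
    and cinner_scaleC_left: "cinner (a *\<^sub>C x) y = a * cinner x y"
    and inner_eq_Re_cinner: "inner x y = Re (cinner x y)"

class chilbert_space = complex_inner + complete_space

context complex_inner
begin

lemma cinner_scaleC_right: "cinner x (a *\<^sub>C y) = cnj a * cinner x y"
  by (metis cinner_commute cinner_scaleC_left complex_cnj_mult)

lemma Im_cinner: "Im (cinner x y) = inner x (\<i> *\<^sub>C y)"
  by (simp add: inner_eq_Re_cinner cinner_scaleC_right)

lemma Im_cinner': "Im (cinner x y) = inner ((- \<i>) *\<^sub>C x) y"
  by (simp add: inner_eq_Re_cinner cinner_scaleC_left)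

lemma norm_scaleC: "norm (a *\<^sub>C x) = cmod a * norm x"
proof -
  have im: "Im (cinner x x) = 0"
    using cinner_commute[of x x] by (simp add: complex_eq_iff)
  have "cinner (a *\<^sub>C x) (a *\<^sub>C x) = complex_of_real ((cmod a)\<^sup>2) * cinner x x"
    by (simp only: cinner_scaleC_left cinner_scaleC_right complex_norm_square mult.assoc
        mult.left_commute)
  then have "inner (a *\<^sub>C x) (a *\<^sub>C x) = (cmod a)\<^sup>2 * inner x x"
    by (simp add: inner_eq_Re_cinner im)
  then show ?thesis
    by (simp add: norm_eq_sqrt_inner real_sqrt_mult)
qed

end

lemma bounded_linear_scaleC: "bounded_linear (\<lambda>x::'a::complex_inner. a *\<^sub>C x)"
proof (rule bounded_linear_intro[where K = "cmod a"])
  fix r and x :: 'a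
  show "a *\<^sub>C (r *\<^sub>R x) = r *\<^sub>R (a *\<^sub>C x)"
    by (metis scaleC_of_real scaleC_scaleC mult.commute)
qed (simp_all add: scaleC_add_right norm_scaleC)


section \<open>Bounded operators\<close>

text \<open>
  Elements of \<open>'a \<Rightarrow>\<^sub>L 'a\<close> are only real-linear. B(K) consists of the complex-linear ones.
\<close>

definition clinear_op :: "('a::complex_inner \<Rightarrow>\<^sub>L 'a) \<Rightarrow> bool" where
  "clinear_op A \<longleftrightarrow> (\<forall>c x. A (c *\<^sub>C x) = c *\<^sub>C A x)"

instantiation blinfun :: (real_normed_vector, complex_inner) scaleC
begin

lift_definition scaleC_blinfun :: "complex \<Rightarrow> 'a \<Rightarrow>\<^sub>L 'b \<Rightarrow> 'a \<Rightarrow>\<^sub>L 'b"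
  is "\<lambda>c A x. c *\<^sub>C A x"
  by (rule bounded_linear_compose[OF bounded_linear_scaleC])

instance ..

end

text \<open>
  The adjoint, for complex-linear operators on a Hilbert space; it exists and is unique
  by \<open>cadjoint_exists\<close> below.
\<close>

definition cadjoint :: "('a::complex_inner \<Rightarrow>\<^sub>L 'a) \<Rightarrow> 'a \<Rightarrow>\<^sub>L 'a" where
  "cadjoint A = (THE B. \<forall>x y. cinner (A x) y = cinner x (blinfun_apply B y))"

definition Re_op :: "('a::complex_inner \<Rightarrow>\<^sub>L 'a) \<Rightarrow> 'a \<Rightarrow>\<^sub>L 'a" where
  "Re_op A = (1/2) *\<^sub>R (A + cadjoint A)"

definition op_le :: "('a::complex_inner \<Rightarrow>\<^sub>L 'a) \<Rightarrow> ('a \<Rightarrow>\<^sub>L 'a) \<Rightarrow> bool" where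
  "op_le A B \<longleftrightarrow> (\<forall>x. cinner ((B - A) x) x \<in> \<real>\<^sub>\<ge>\<^sub>0)"

text \<open>
  The free semigroup on n generators is the type of words \<open>'n list\<close> over a finite type
  with n elements; the empty word is the identity.
\<close>

definition op_word :: "('n \<Rightarrow> 'a \<Rightarrow>\<^sub>L 'a) \<Rightarrow> 'n list \<Rightarrow> 'a::real_normed_vector \<Rightarrow>\<^sub>L 'a" where
  "op_word T \<alpha> = foldr (\<lambda>i A. T i o\<^sub>L A) \<alpha> id_blinfun"

definition scalar_word :: "real ^ 'n \<Rightarrow> 'n list \<Rightarrow> real" where
  "scalar_word r \<alpha> = (\<Prod>i\<leftarrow>\<alpha>. r $ i)"

definition row_ball :: "real \<Rightarrow> ('n::finite \<Rightarrow> 'a::complex_inner \<Rightarrow>\<^sub>L 'a) set" where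
  "row_ball r = {T. (\<forall>i. clinear_op (T i)) \<and>
     sqrt (norm (\<Sum>i\<in>UNIV. T i o\<^sub>L cadjoint (T i))) \<le> r}"


subsection \<open>Existence of adjoints\<close>

lemma riesz_representation:
  fixes f :: "'a::{real_inner, complete_space} \<Rightarrow> real"
  assumes "bounded_linear f"
  obtains y where "\<And>x. f x = inner x y"
proof -
  interpret f: bounded_linear f by fact
  define J where "J x = (norm x)\<^sup>2 / 2 - f x" for x
  obtain C where C: "\<And>x. norm (f x) \<le> norm x * C"
    using f.bounded by blast
  have lb: "- (C\<^sup>2 / 2) \<le> J x" for x
  proof -
    have "0 \<le> (norm x - C)\<^sup>2" by simp
    moreover have "f x \<le> norm x * C" using C[of x] by simp
    ultimately show ?thesis by (simp add: J_def power2_diff)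
  qed
  then have bdd: "bdd_below (range J)" by (auto intro!: bdd_belowI)
  define m where "m = Inf (range J)"
  have m: "m \<le> J x" for x unfolding m_def by (rule cInf_lower) (use bdd in auto)
  have par: "(norm (x - y))\<^sup>2 / 4 = J x + J y - 2 * J ((1/2) *\<^sub>R (x + y))" for x y
    by (simp add: J_def f.scaleR f.add power2_norm_eq_inner inner_simps inner_commute field_simps)
  have "\<exists>x. J x < m + inverse (real (Suc n))" for n
    using cInf_lessD[of "range J" "m + inverse (real (Suc n))"] m_def by auto
  then obtain X where X: "\<And>n. J (X n) < m + inverse (real (Suc n))" by metis
  have JX: "(\<lambda>n. J (X n)) \<longlonglongrightarrow> m"
  proof (rule tendsto_sandwich[OF _ _ tendsto_const])
    show "(\<lambda>n. m + inverse (real (Suc n))) \<longlonglongrightarrow> m"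
      using tendsto_add[OF tendsto_const LIMSEQ_inverse_real_of_nat] by simp
  qed (use m X in \<open>auto intro!: always_eventually less_imp_le\<close>)
  have "Cauchy X"
  proof (rule metric_CauchyI)
    fix e :: real assume e: "0 < e"
    have "eventually (\<lambda>n. J (X n) < m + e\<^sup>2 / 8) sequentially"
      by (rule order_tendstoD[OF JX]) (use e in simp)
    then obtain N where N: "\<And>n. n \<ge> N \<Longrightarrow> J (X n) < m + e\<^sup>2 / 8"
      by (auto simp: eventually_sequentially)
    have "dist (X a) (X b) < e" if "a \<ge> N" "b \<ge> N" for a b
    proof -
      have "(norm (X a - X b))\<^sup>2 / 4 < e\<^sup>2 / 4"
        using par[of "X a" "X b"] N[OF that(1)] N[OF that(2)] m[of "(1/2) *\<^sub>R (X a + X b)"]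
        by linarith
      then have "(norm (X a - X b))\<^sup>2 < e\<^sup>2" by simp
      then show ?thesis using e by (simp add: dist_norm power_less_imp_less_base)
    qed
    then show "\<exists>M. \<forall>m\<ge>M. \<forall>n\<ge>M. dist (X m) (X n) < e" by blast
  qed
  then obtain y where y: "X \<longlonglongrightarrow> y"
    using Cauchy_convergent convergent_def by blast
  have "(\<lambda>n. J (X n)) \<longlonglongrightarrow> J y"
    unfolding J_def by (intro tendsto_intros y f.tendsto)
       simp
  then have Jy: "J y = m" using JX LIMSEQ_unique by blast
  have "f x = inner x y" for x
  proof -
    define d where "d = inner x y - f x"
    have q: "0 \<le> t * d + t\<^sup>2 * (norm x)\<^sup>2 / 2" for t
    proof -
      have "J (y + t *\<^sub>R x) = J y + t * d + t\<^sup>2 * (norm x)\<^sup>2 / 2"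
        unfolding J_def d_def power2_norm_eq_inner
        by (simp add: f.add f.scaleR inner_simps inner_commute[of x y] field_simps power2_eq_square)
      then show ?thesis using m[of "y + t *\<^sub>R x"] Jy by simp
    qed
    define a where "a = (norm x)\<^sup>2 + 1"
    have a: "a > 0" "(norm x)\<^sup>2 \<le> a" by (simp_all add: a_def add_nonneg_pos)
    have "0 \<le> - (d / a) * d + (d / a)\<^sup>2 * (norm x)\<^sup>2 / 2"
      using q[of "- (d / a)"] by simp
    also have "\<dots> \<le> - (d / a) * d + (d / a)\<^sup>2 * a / 2"
      using a by (intro add_left_mono divide_right_mono mult_left_mono) auto
    also have "\<dots> = - (d\<^sup>2 / (2 * a))"
      using a by (simp add: field_simps power2_eq_square)
    finally have "d\<^sup>2 / (2 * a) \<le> 0" by simp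
    then have "d\<^sup>2 \<le> 0" using a by (simp add: divide_le_0_iff)
    then have "d = 0" by simp
    then show ?thesis by (simp add: d_def)
  qed
  then show ?thesis by (rule that)
qed

lemma cadjoint_exists:
  fixes A :: "'a::chilbert_space \<Rightarrow>\<^sub>L 'a"
  assumes "clinear_op A"
  shows "\<exists>!B. \<forall>x y. cinner (A x) y = cinner x (blinfun_apply B y)"
proof -
  have "\<exists>z. \<forall>x. inner (A x) y = inner x z" for y
    using riesz_representation[of "\<lambda>x. inner (A x) y"]
    by (metis blinfun.bounded_linear_right bounded_linear_inner_left_comp)
  then obtain g where g: "\<And>x y. inner (A x) y = inner x (g y)" by metis
  have eqI: "u = v" if "\<And>x. inner x u = inner x v" for u v :: 'a
    using that[of "u - v"] by (metis inner_diff_right inner_eq_zero_iff eq_iff_diff_eq_0)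
  have "bounded_linear g"
  proof (rule bounded_linear_intro[where K = "norm A"])
    show "g (x + y) = g x + g y" for x y
      by (rule eqI) (simp add: inner_add_right flip: g)
    show "g (r *\<^sub>R x) = r *\<^sub>R g x" for r x
      by (rule eqI) (simp flip: g)
    show "norm (g x) \<le> norm x * norm A" for x
    proof (cases "g x = 0")
      case False
      have "norm (g x) * norm (g x) = inner (A (g x)) x"
        by (simp add: g flip: power2_eq_square power2_norm_eq_inner)
      also have "\<dots> \<le> norm (A (g x)) * norm x" by (rule norm_cauchy_schwarz)
      also have "\<dots> \<le> (norm A * norm (g x)) * norm x"
        by (intro mult_right_mono norm_blinfun) simp
      finally show ?thesis using False by (simp add: mult.commute mult.left_commute)
    qed simp
  qed
  then have ap: "blinfun_apply (Blinfun g) = g" by (rule bounded_linear_Blinfun_apply)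
  show ?thesis
  proof (rule ex1I[of _ "Blinfun g"])
    show "\<forall>x y. cinner (A x) y = cinner x (Blinfun g y)"
    proof (intro allI complex_eqI)
      fix x y
      show "Re (cinner (A x) y) = Re (cinner x (Blinfun g y))"
        using g[of x y] by (simp add: inner_eq_Re_cinner ap)
      have "Im (cinner (A x) y) = inner (A ((- \<i>) *\<^sub>C x)) y"
        using assms by (simp only: Im_cinner' clinear_op_def)
      then show "Im (cinner (A x) y) = Im (cinner x (Blinfun g y))"
        by (simp only: g Im_cinner' ap)
    qed
  next
    fix B assume B: "\<forall>x y. cinner (A x) y = cinner x (blinfun_apply B y)"
    have "blinfun_apply B y = g y" for y
      by (rule eqI) (metis B g inner_eq_Re_cinner)
    then show "B = Blinfun g" by (intro blinfun_eqI) (simp add: ap)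
  qed
qed

lemma cinner_cadjoint:
  fixes A :: "'a::chilbert_space \<Rightarrow>\<^sub>L 'a"
  assumes "clinear_op A"
  shows "cinner (A x) y = cinner x (cadjoint A y)"
  using theI'[OF cadjoint_exists[OF assms]] unfolding cadjoint_def by blast


section \<open>The full Fock space\<close>

text \<open>
  For an n-dimensional space with orthonormal basis indexed by \<open>'n\<close>, the k-th tensor power
  has the orthonormal basis of elementary tensors of basis vectors, indexed by the words of
  length k. An element of the k-th tensor power is thus given by its coordinates at the words
  of length k, and an element of the Hilbert direct sum over all k by its coordinates at all
  words.
\<close>

abbreviation words :: "nat \<Rightarrow> 'n list set" where
  "words k \<equiv> {\<alpha>. length \<alpha> = k}"

typedef ('n::finite) fock =
  "{\<phi> :: 'n list \<Rightarrow> complex. summable (\<lambda>k. \<Sum>\<alpha>\<in>words k. (cmod (\<phi> \<alpha>))\<^sup>2)}"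
  morphisms coord Abs_fock
  by (rule exI[of _ "\<lambda>_. 0"]) simp

setup_lifting type_definition_fock

lemma finite_words [simp]: "finite (words k :: 'n::finite list set)"
  using finite_lists_length_eq[of "UNIV :: 'n set" k] by simp

lemma fock_eqI: "(\<And>\<alpha>. coord \<phi> \<alpha> = coord \<psi> \<alpha>) \<Longrightarrow> \<phi> = \<psi>"
  by transfer auto

lemma summable_coord: "summable (\<lambda>k. \<Sum>\<alpha>\<in>words k. (cmod (coord \<phi> \<alpha>))\<^sup>2)"
  using coord by blast

lemma summable_words_add:
  fixes f g :: "'n::finite list \<Rightarrow> complex"
  assumes "summable (\<lambda>k. \<Sum>\<alpha>\<in>words k. (cmod (f \<alpha>))\<^sup>2)"
    and "summable (\<lambda>k. \<Sum>\<alpha>\<in>words k. (cmod (g \<alpha>))\<^sup>2)"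
  shows "summable (\<lambda>k. \<Sum>\<alpha>\<in>words k. (cmod (f \<alpha> + g \<alpha>))\<^sup>2)"
proof (rule summable_comparison_test')
  show "summable (\<lambda>k. 2 * (\<Sum>\<alpha>\<in>words k. (cmod (f \<alpha>))\<^sup>2) + 2 * (\<Sum>\<alpha>\<in>words k. (cmod (g \<alpha>))\<^sup>2))"
    using assms by (intro summable_add summable_mult)
  have "(cmod (f \<alpha> + g \<alpha>))\<^sup>2 \<le> 2 * (cmod (f \<alpha>))\<^sup>2 + 2 * (cmod (g \<alpha>))\<^sup>2" for \<alpha>
  proof -
    have "(cmod (f \<alpha> + g \<alpha>))\<^sup>2 \<le> (cmod (f \<alpha>) + cmod (g \<alpha>))\<^sup>2"
      by (intro power_mono norm_triangle_ineq norm_ge_zero)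
    also have "\<dots> \<le> 2 * (cmod (f \<alpha>))\<^sup>2 + 2 * (cmod (g \<alpha>))\<^sup>2"
      using zero_le_power2[of "cmod (f \<alpha>) - cmod (g \<alpha>)"]
      unfolding power2_sum power2_diff by linarith
    finally show ?thesis .
  qed
  then show "norm (\<Sum>\<alpha>\<in>words k. (cmod (f \<alpha> + g \<alpha>))\<^sup>2)
      \<le> 2 * (\<Sum>\<alpha>\<in>words k. (cmod (f \<alpha>))\<^sup>2) + 2 * (\<Sum>\<alpha>\<in>words k. (cmod (g \<alpha>))\<^sup>2)" for k
    by (simp add: sum_nonneg sum_distrib_left sum_mono flip: sum.distrib)
qed

lemma summable_words_scale:
  fixes f :: "'n::finite list \<Rightarrow> complex"
  assumes "summable (\<lambda>k. \<Sum>\<alpha>\<in>words k. (cmod (f \<alpha>))\<^sup>2)"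
  shows "summable (\<lambda>k. \<Sum>\<alpha>\<in>words k. (cmod (c * f \<alpha>))\<^sup>2)"
  using summable_mult[OF assms, of "(cmod c)\<^sup>2"]
  by (simp add: norm_mult power_mult_distrib sum_distrib_left)

lemma summable_cinner_fock:
  "summable (\<lambda>k. \<Sum>\<alpha>\<in>words k. coord \<phi> \<alpha> * cnj (coord \<psi> \<alpha>))"
proof (rule summable_comparison_test')
  show "summable (\<lambda>k. (\<Sum>\<alpha>\<in>words k. (cmod (coord \<phi> \<alpha>))\<^sup>2) + (\<Sum>\<alpha>\<in>words k. (cmod (coord \<psi> \<alpha>))\<^sup>2))"
    by (intro summable_add summable_coord)
  have "norm (coord \<phi> \<alpha> * cnj (coord \<psi> \<alpha>)) \<le> (cmod (coord \<phi> \<alpha>))\<^sup>2 + (cmod (coord \<psi> \<alpha>))\<^sup>2" for \<alpha>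
  proof -
    have "0 \<le> cmod (coord \<phi> \<alpha>) * cmod (coord \<psi> \<alpha>)" by simp
    then show ?thesis
      using zero_le_power2[of "cmod (coord \<phi> \<alpha>) - cmod (coord \<psi> \<alpha>)"]
      unfolding power2_diff norm_mult complex_mod_cnj by linarith
  qed
  then show "norm (\<Sum>\<alpha>\<in>words k. coord \<phi> \<alpha> * cnj (coord \<psi> \<alpha>))
      \<le> (\<Sum>\<alpha>\<in>words k. (cmod (coord \<phi> \<alpha>))\<^sup>2) + (\<Sum>\<alpha>\<in>words k. (cmod (coord \<psi> \<alpha>))\<^sup>2)" for k
    by (simp add: sum_norm_le flip: sum.distrib)
qed

instantiation fock :: (finite) complex_inner
begin

lift_definition zero_fock :: "'a fock" is "\<lambda>_. 0" by simp

lift_definition plus_fock :: "'a fock \<Rightarrow> 'a fock \<Rightarrow> 'a fock" is "\<lambda>\<phi> \<psi> \<alpha>. \<phi> \<alpha> + \<psi> \<alpha>"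
  by (rule summable_words_add)

lift_definition scaleC_fock :: "complex \<Rightarrow> 'a fock \<Rightarrow> 'a fock" is "\<lambda>c \<phi> \<alpha>. c * \<phi> \<alpha>"
  by (rule summable_words_scale)

definition scaleR_fock :: "real \<Rightarrow> 'a fock \<Rightarrow> 'a fock" where
  "scaleR_fock r \<phi> = complex_of_real r *\<^sub>C \<phi>"

definition uminus_fock :: "'a fock \<Rightarrow> 'a fock" where
  "uminus_fock \<phi> = (- 1) *\<^sub>C \<phi>"

definition minus_fock :: "'a fock \<Rightarrow> 'a fock \<Rightarrow> 'a fock" where
  "minus_fock \<phi> \<psi> = \<phi> + (- \<psi>)"

definition cinner_fock :: "'a fock \<Rightarrow> 'a fock \<Rightarrow> complex" where
  "cinner_fock \<phi> \<psi> = (\<Sum>k. \<Sum>\<alpha>\<in>words k. coord \<phi> \<alpha> * cnj (coord \<psi> \<alpha>))"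

definition inner_fock :: "'a fock \<Rightarrow> 'a fock \<Rightarrow> real" where
  "inner_fock \<phi> \<psi> = Re (cinner \<phi> \<psi>)"

definition norm_fock :: "'a fock \<Rightarrow> real" where
  "norm_fock \<phi> = sqrt (inner \<phi> \<phi>)"

definition sgn_fock :: "'a fock \<Rightarrow> 'a fock" where
  "sgn_fock \<phi> = inverse (norm \<phi>) *\<^sub>R \<phi>"

definition dist_fock :: "'a fock \<Rightarrow> 'a fock \<Rightarrow> real" where
  "dist_fock \<phi> \<psi> = norm (\<phi> - \<psi>)"

definition uniformity_fock :: "('a fock \<times> 'a fock) filter" where
  "uniformity_fock = (INF e\<in>{0 <..}. principal {(x, y). dist x y < e})"

definition open_fock :: "'a fock set \<Rightarrow> bool" where
  "open_fock U = (\<forall>x\<in>U. \<forall>\<^sub>F (x', y) in uniformity. x' = x \<longrightarrow> y \<in> U)"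

lemma coord_simps_aux:
  "coord 0 \<alpha> = 0"
  "coord (\<phi> + \<psi>) \<alpha> = coord \<phi> \<alpha> + coord \<psi> \<alpha>"
  "coord (c *\<^sub>C \<phi>) \<alpha> = c * coord \<phi> \<alpha>"
  "coord (r *\<^sub>R \<phi>) \<alpha> = complex_of_real r * coord \<phi> \<alpha>"
  "coord (- \<phi>) \<alpha> = - coord \<phi> \<alpha>"
  "coord (\<phi> - \<psi>) \<alpha> = coord \<phi> \<alpha> - coord \<psi> \<alpha>"
  for \<phi> :: "'a fock"
  by (simp_all add: zero_fock.rep_eq plus_fock.rep_eq scaleC_fock.rep_eq scaleR_fock_def
      uminus_fock_def minus_fock_def)

lemma inner_self_aux:
  "inner \<phi> \<phi> = (\<Sum>k. \<Sum>\<alpha>\<in>words k. (cmod (coord \<phi> \<alpha>))\<^sup>2)"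
  for \<phi> :: "'a fock"
proof -
  have "cinner \<phi> \<phi> = (\<Sum>k. complex_of_real (\<Sum>\<alpha>\<in>words k. (cmod (coord \<phi> \<alpha>))\<^sup>2))"
    by (simp only: cinner_fock_def complex_norm_square[symmetric] of_real_sum)
  also have "\<dots> = complex_of_real (\<Sum>k. \<Sum>\<alpha>\<in>words k. (cmod (coord \<phi> \<alpha>))\<^sup>2)"
    by (rule suminf_of_real[OF summable_coord, symmetric])
  finally show ?thesis by (simp add: inner_fock_def)
qed

instance
proof
  fix x y z :: "'a fock" and a b :: complex and r s :: real
  show "x + y + z = x + (y + z)" "x + y = y + x" "0 + x = x" "- x + x = 0" "x - y = x + - y"
    "r *\<^sub>R (x + y) = r *\<^sub>R x + r *\<^sub>R y" "(r + s) *\<^sub>R x = r *\<^sub>R x + s *\<^sub>R x"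
    "r *\<^sub>R s *\<^sub>R x = (r * s) *\<^sub>R x" "1 *\<^sub>R x = x"
    "a *\<^sub>C (x + y) = a *\<^sub>C x + a *\<^sub>C y" "(a + b) *\<^sub>C x = a *\<^sub>C x + b *\<^sub>C x"
    "a *\<^sub>C b *\<^sub>C x = (a * b) *\<^sub>C x" "complex_of_real r *\<^sub>C x = r *\<^sub>R x"
    by (rule fock_eqI, simp add: coord_simps_aux algebra_simps)+
  show "dist x y = norm (x - y)" "sgn x = inverse (norm x) *\<^sub>R x" "norm x = sqrt (inner x x)"
    "inner x y = Re (cinner x y)"
    by (simp_all add: dist_fock_def sgn_fock_def norm_fock_def inner_fock_def)
  show "uniformity = (INF e\<in>{0 <..}. principal {(x :: 'a fock, y). dist x y < e})"
    by (rule uniformity_fock_def)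
  show "open U = (\<forall>x\<in>U. \<forall>\<^sub>F (x', y) in uniformity. x' = x \<longrightarrow> y \<in> U)" for U :: "'a fock set"
    by (rule open_fock_def)
  show comm: "cinner x y = cnj (cinner y x)" for x y :: "'a fock"
  proof -
    have "(\<lambda>k. \<Sum>\<alpha>\<in>words k. coord y \<alpha> * cnj (coord x \<alpha>)) sums cinner y x"
      unfolding cinner_fock_def by (rule summable_sums[OF summable_cinner_fock])
    then have "(\<lambda>k. cnj (\<Sum>\<alpha>\<in>words k. coord y \<alpha> * cnj (coord x \<alpha>))) sums cnj (cinner y x)"
      by (simp only: sums_cnj)
    then have "(\<lambda>k. \<Sum>\<alpha>\<in>words k. coord x \<alpha> * cnj (coord y \<alpha>)) sums cnj (cinner y x)"
      by (simp add: mult.commute)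
    then show ?thesis unfolding cinner_fock_def[of x y] by (rule sums_unique[symmetric])
  qed
  show add: "cinner (x + y) z = cinner x z + cinner y z"
    unfolding cinner_fock_def
    by (simp add: suminf_add summable_cinner_fock coord_simps_aux distrib_right flip: sum.distrib)
  show scale: "cinner (a *\<^sub>C x) y = a * cinner x y" for a and x y :: "'a fock"
    unfolding cinner_fock_def
    by (simp add: suminf_mult[symmetric] summable_cinner_fock coord_simps_aux sum_distrib_left
        mult.assoc)
  show "inner x y = inner y x"
    unfolding inner_fock_def using comm[of x y] by simp
  show "inner (x + y) z = inner x z + inner y z"
    by (simp add: inner_fock_def add)
  show "inner (r *\<^sub>R x) y = r * inner x y"
    by (simp add: inner_fock_def scaleR_fock_def scale)
  show "0 \<le> inner x x"
    unfolding inner_self_aux by (intro suminf_nonneg summable_coord sum_nonneg) simp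
  show "(inner x x = 0) = (x = 0)"
  proof
    assume "inner x x = 0"
    then have "\<forall>k. (\<Sum>\<alpha>\<in>words k. (cmod (coord x \<alpha>))\<^sup>2) = 0"
      unfolding inner_self_aux by (subst (asm) suminf_eq_zero_iff) (auto intro: summable_coord sum_nonneg)
    then have "coord x \<alpha> = 0" for \<alpha>
      by (simp add: sum_nonneg_eq_0_iff)
    then show "x = 0" by (intro fock_eqI) (simp add: coord_simps_aux)
  qed (simp add: inner_self_aux coord_simps_aux)
qed

end

lemma coord_simps [simp]:
  "coord 0 \<alpha> = 0"
  "coord (\<phi> + \<psi>) \<alpha> = coord \<phi> \<alpha> + coord \<psi> \<alpha>"
  "coord (c *\<^sub>C \<phi>) \<alpha> = c * coord \<phi> \<alpha>"
  "coord (r *\<^sub>R \<phi>) \<alpha> = complex_of_real r * coord \<phi> \<alpha>"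
  "coord (- \<phi>) \<alpha> = - coord \<phi> \<alpha>"
  "coord (\<phi> - \<psi>) \<alpha> = coord \<phi> \<alpha> - coord \<psi> \<alpha>"
  by (fact coord_simps_aux)+

lemma norm_fock_square: "(norm \<phi>)\<^sup>2 = (\<Sum>k. \<Sum>\<alpha>\<in>words k. (cmod (coord \<phi> \<alpha>))\<^sup>2)"
  by (simp only: power2_norm_eq_inner inner_self_aux)

lemma sum_coord_le_norm:
  "(\<Sum>k<N. \<Sum>\<alpha>\<in>words k. (cmod (coord \<phi> \<alpha>))\<^sup>2) \<le> (norm \<phi>)\<^sup>2"
  unfolding norm_fock_square
  by (rule sum_le_suminf) (auto intro: summable_coord sum_nonneg)

lemma cmod_coord_le_norm: "cmod (coord \<phi> \<alpha>) \<le> norm \<phi>"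
proof -
  have "(cmod (coord \<phi> \<alpha>))\<^sup>2 \<le> (\<Sum>\<beta>\<in>words (length \<alpha>). (cmod (coord \<phi> \<beta>))\<^sup>2)"
    by (rule member_le_sum) auto
  also have "\<dots> \<le> (\<Sum>k<Suc (length \<alpha>). \<Sum>\<beta>\<in>words k. (cmod (coord \<phi> \<beta>))\<^sup>2)"
    by (simp add: sum_nonneg)
  also have "\<dots> \<le> (norm \<phi>)\<^sup>2" by (rule sum_coord_le_norm)
  finally show ?thesis by (rule power2_le_imp_le) simp
qed

instance fock :: (finite) chilbert_space
proof
  fix X :: "nat \<Rightarrow> 'a fock" assume X: "Cauchy X"
  have "Cauchy (\<lambda>n. coord (X n) \<alpha>)" for \<alpha>
  proof (rule metric_CauchyI)
    fix e :: real assume "0 < e"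
    then obtain M where M: "\<And>m n. m \<ge> M \<Longrightarrow> n \<ge> M \<Longrightarrow> dist (X m) (X n) < e"
      using metric_CauchyD[OF X] by blast
    have "dist (coord (X m) \<alpha>) (coord (X n) \<alpha>) < e" if "m \<ge> M" "n \<ge> M" for m n
      using M[OF that] cmod_coord_le_norm[of "X m - X n" \<alpha>] by (simp add: dist_norm)
    then show "\<exists>M. \<forall>m\<ge>M. \<forall>n\<ge>M. dist (coord (X m) \<alpha>) (coord (X n) \<alpha>) < e" by blast
  qed
  then have "\<exists>l. (\<lambda>n. coord (X n) \<alpha>) \<longlonglongrightarrow> l" for \<alpha>
    using Cauchy_convergent convergent_def by blast
  then obtain f where f: "\<And>\<alpha>. (\<lambda>n. coord (X n) \<alpha>) \<longlonglongrightarrow> f \<alpha>" by metis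
  have tail: "(\<Sum>k<N. \<Sum>\<alpha>\<in>words k. (cmod (coord (X m) \<alpha> - f \<alpha>))\<^sup>2) \<le> e\<^sup>2"
    if "\<forall>n\<ge>M. dist (X m) (X n) < e" for e M m N
  proof (rule LIMSEQ_le_const2)
    show "(\<lambda>n. \<Sum>k<N. \<Sum>\<alpha>\<in>words k. (cmod (coord (X m) \<alpha> - coord (X n) \<alpha>))\<^sup>2)
        \<longlonglongrightarrow> (\<Sum>k<N. \<Sum>\<alpha>\<in>words k. (cmod (coord (X m) \<alpha> - f \<alpha>))\<^sup>2)"
      by (intro tendsto_intros f)
    have "(\<Sum>k<N. \<Sum>\<alpha>\<in>words k. (cmod (coord (X m) \<alpha> - coord (X n) \<alpha>))\<^sup>2) \<le> e\<^sup>2" if "n \<ge> M" for n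
    proof -
      have "(\<Sum>k<N. \<Sum>\<alpha>\<in>words k. (cmod (coord (X m) \<alpha> - coord (X n) \<alpha>))\<^sup>2) \<le> (norm (X m - X n))\<^sup>2"
        using sum_coord_le_norm[where \<phi> = "X m - X n"] by simp
      also have "\<dots> \<le> e\<^sup>2"
        using \<open>\<forall>n\<ge>M. dist (X m) (X n) < e\<close> that
        by (intro power_mono) (simp_all add: dist_norm less_imp_le)
      finally show ?thesis .
    qed
    then show "\<exists>M. \<forall>n\<ge>M. (\<Sum>k<N. \<Sum>\<alpha>\<in>words k. (cmod (coord (X m) \<alpha> - coord (X n) \<alpha>))\<^sup>2) \<le> e\<^sup>2"
      by blast
  qed
  have summ: "summable (\<lambda>k. \<Sum>\<alpha>\<in>words k. (cmod (coord (X m) \<alpha> - f \<alpha>))\<^sup>2)"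
    if "\<forall>n\<ge>M. dist (X m) (X n) < e" for e M m
    using tail[OF that] by (intro summableI_nonneg_bounded[where x = "e\<^sup>2"] sum_nonneg) simp_all
  obtain M1 where M1: "\<And>m n. m \<ge> M1 \<Longrightarrow> n \<ge> M1 \<Longrightarrow> dist (X m) (X n) < 1"
    using metric_CauchyD[OF X, of 1] by auto
  have "summable (\<lambda>k. \<Sum>\<alpha>\<in>words k. (cmod (coord (X M1) \<alpha> + (-1) * (coord (X M1) \<alpha> - f \<alpha>)))\<^sup>2)"
    using M1 by (intro summable_words_add summable_words_scale summable_coord summ[of M1 M1 1]) simp
  then have f_in: "summable (\<lambda>k. \<Sum>\<alpha>\<in>words k. (cmod (f \<alpha>))\<^sup>2)" by simp
  then have cF: "coord (Abs_fock f) = f" by (simp add: Abs_fock_inverse)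
  have "X \<longlonglongrightarrow> Abs_fock f"
  proof (rule metric_LIMSEQ_I)
    fix r :: real assume r: "0 < r"
    then obtain M where M: "\<And>m n. m \<ge> M \<Longrightarrow> n \<ge> M \<Longrightarrow> dist (X m) (X n) < r / 2"
      using metric_CauchyD[OF X, of "r / 2"] by auto
    have "dist (X m) (Abs_fock f) < r" if "m \<ge> M" for m
    proof -
      have d: "\<forall>n\<ge>M. dist (X m) (X n) < r / 2"
        using M[OF that] by blast
      have "(norm (X m - Abs_fock f))\<^sup>2 \<le> (r / 2)\<^sup>2"
        unfolding norm_fock_square coord_simps cF
        by (rule suminf_le_const[OF summ[OF d] tail[OF d]])
      then have "norm (X m - Abs_fock f) \<le> r / 2"
        by (rule power2_le_imp_le) (use r in simp)
      then show ?thesis using r by (simp add: dist_norm)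
    qed
    then show "\<exists>M. \<forall>m\<ge>M. dist (X m) (Abs_fock f) < r" by blast
  qed
  then show "convergent X" by (auto simp: convergent_def)
qed

lemma words_Suc: "(words (Suc k) :: 'n list set) = (\<lambda>(i, \<beta>). i # \<beta>) ` (UNIV \<times> words k)"
  by (auto simp: length_Suc_conv image_iff)

lemma sum_words_Suc:
  "(\<Sum>\<alpha>\<in>words (Suc k). g \<alpha>) = (\<Sum>i\<in>UNIV. \<Sum>\<beta>\<in>words k. g (i # \<beta>))"
  for g :: "'n::finite list \<Rightarrow> 'b::comm_monoid_add"
  unfolding words_Suc
  by (subst sum.reindex) (auto simp: inj_on_def sum.cartesian_product case_prod_unfold)

lemma words_0: "words 0 = {[]}"
  by auto

lemma sum_words_tensor:
  fixes h :: "complex ^ 'n"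
  shows "(\<Sum>\<alpha>\<in>words (Suc k). (cmod (case \<alpha> of [] \<Rightarrow> 0 | i # \<beta> \<Rightarrow> h $ i * \<phi> \<beta>))\<^sup>2)
    = (norm h)\<^sup>2 * (\<Sum>\<beta>\<in>words k. (cmod (\<phi> \<beta>))\<^sup>2)"
proof -
  have "(norm h)\<^sup>2 = (\<Sum>i\<in>UNIV. (cmod (h $ i))\<^sup>2)"
    by (simp add: norm_vec_def L2_set_def sum_nonneg)
  then show ?thesis
    by (simp add: sum_words_Suc norm_mult power_mult_distrib sum_product)
qed

text \<open>
  The tensor product of a vector in \<open>complex ^ 'n\<close> and an element of the Fock space: the
  coordinate of \<open>h \<otimes> \<phi>\<close> at the word \<open>i # \<beta>\<close> is the product of the coordinates of \<open>h\<close>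
  at \<open>i\<close> and of \<open>\<phi>\<close> at \<open>\<beta>\<close>.
\<close>

lift_definition tensor :: "complex ^ 'n \<Rightarrow> 'n::finite fock \<Rightarrow> 'n fock" is
  "\<lambda>h \<phi> \<alpha>. case \<alpha> of [] \<Rightarrow> 0 | i # \<beta> \<Rightarrow> h $ i * \<phi> \<beta>"
proof -
  fix h :: "complex ^ 'n" and \<phi> :: "'n list \<Rightarrow> complex"
  assume "summable (\<lambda>k. \<Sum>\<alpha>\<in>words k. (cmod (\<phi> \<alpha>))\<^sup>2)"
  then have "summable (\<lambda>k. (norm h)\<^sup>2 * (\<Sum>\<alpha>\<in>words k. (cmod (\<phi> \<alpha>))\<^sup>2))"
    by (rule summable_mult)
  then show "summable (\<lambda>k. \<Sum>\<alpha>\<in>words k. (cmod (case \<alpha> of [] \<Rightarrow> 0 | i # \<beta> \<Rightarrow> h $ i * \<phi> \<beta>))\<^sup>2)"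
    unfolding sum_words_tensor[symmetric] by (rule iffD1[OF summable_Suc_iff])
qed

lemma norm_tensor: "norm (tensor h \<phi>) = norm h * norm \<phi>"
proof -
  have "(norm (tensor h \<phi>))\<^sup>2 = (norm h * norm \<phi>)\<^sup>2"
    using suminf_split_head[OF summable_coord[of "tensor h \<phi>"]]
    by (simp add: norm_fock_square power_mult_distrib tensor.rep_eq sum_words_tensor words_0
        suminf_mult summable_coord)
  then show ?thesis by simp
qed

lemma bounded_linear_tensor: "bounded_linear (tensor h)"
proof (rule bounded_linear_intro[where K = "norm h"])
  show "tensor h (\<phi> + \<psi>) = tensor h \<phi> + tensor h \<psi>" for \<phi> \<psi>
    by (rule fock_eqI) (simp add: tensor.rep_eq distrib_left split: list.split)
  show "tensor h (r *\<^sub>R \<phi>) = r *\<^sub>R tensor h \<phi>" for r \<phi>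
    by (rule fock_eqI) (simp add: tensor.rep_eq mult.left_commute split: list.split)
  show "norm (tensor h \<phi>) \<le> norm \<phi> * norm h" for \<phi>
    by (simp only: norm_tensor mult.commute order_refl)
qed

lift_definition creation :: "'n::finite \<Rightarrow> 'n fock \<Rightarrow>\<^sub>L 'n fock" is "\<lambda>i. tensor (axis i 1)"
  by (rule bounded_linear_tensor)

lemma clinear_creation: "clinear_op (creation i)"
  unfolding clinear_op_def creation.rep_eq
  by (intro allI fock_eqI) (simp add: tensor.rep_eq mult.left_commute split: list.split)


section \<open>The radii\<close>

definition radius_eq :: "nat \<Rightarrow> real \<Rightarrow> bool" where
  "radius_eq m t \<longleftrightarrow>
     (\<Sum>k=1..m-1. t ^ k * cos (pi / (of_int \<lfloor>real (m - 1) / real k\<rfloor> + 2))) = 1/2"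

text \<open>
  The positive solution of \<open>radius_eq m\<close>, which exists and is unique only for \<open>m \<ge> 2\<close>.
\<close>

definition radius :: "nat \<Rightarrow> real" where
  "radius m = (THE t. 0 < t \<and> radius_eq m t)"

end

theory Submission
  imports Defs
begin

text \<open>
  The heart of the matter is a noncommutative Fejer inequality: for \<open>1 \<le> k \<le> m - 1\<close> the
  Euclidean norm of the coefficients of degree \<open>k\<close> is at most
  \<open>2 (1 - p(0)) cos (\<pi> / ([(m-1)/k] + 2))\<close>. It comes from testing \<open>Re p(S) \<le> I\<close> on
  \<open>1 + v + v \<otimes> v + \<dots>\<close> (\<open>J + 1\<close> terms) for a unit vector \<open>v\<close> of degree \<open>k\<close>, which turns it into a
  one-variable positivity statement, up to a factor tending to 1 with \<open>J\<close>. A row contraction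
  bound for the sums over words of length \<open>k\<close> then gives the Bohr inequality, because the
  equation for the radius says exactly that the resulting bounds add up to 1.
\<close>

section \<open>An inequality of Fejer\<close>

text \<open>The \<open>j\<close>-th powers of the \<open>M\<close>-th roots of -1 form a geometric
  progression whose ratio \<open>q\<close> satisfies \<open>q ^ M = 1\<close>, and \<open>q\<close>
  differs from 1 because \<open>M\<close> does not divide \<open>j\<close>.\<close>

lemma sum_cis_odd_power:
  assumes "0 < j" "j < M"
  shows "(\<Sum>l<M. cis (real (2 * l + 1) * pi / real M) ^ j) = 0"
proof -
  define q where "q = cis (2 * pi * real j / real M)"
  have "q \<noteq> 1"
  proof
    assume "q = 1"
    then have "cos (2 * pi * real j / real M) = 1"
      by (simp add: q_def complex_eq_iff)
    then obtain n :: int where "2 * pi * real j / real M = of_int n * 2 * pi"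
      using cos_one_2pi_int by blast
    then have "real j = of_int n * real M"
      using assms by (simp add: field_simps)
    then have "int j = n * int M"
      by (metis of_int_eq_iff of_int_mult of_int_of_nat_eq)
    then have "int M dvd int j" by simp
    then show False using assms by (simp add: nat_dvd_not_less)
  qed
  moreover have "q ^ M = 1"
    using assms cis_multiple_2pi[of "real j"] by (simp add: q_def Complex.DeMoivre)
  moreover have "cis (real (2 * l + 1) * pi / real M) ^ j = cis (pi * real j / real M) * q ^ l" for l
    unfolding q_def Complex.DeMoivre cis_mult by (simp add: algebra_simps add_divide_distrib)
  ultimately show ?thesis
    by (simp add: geometric_sum flip: sum_distrib_left)
qed

text \<open>Among the \<open>M\<close>-th roots of -1 the rightmost is the one with argument
  \<open>pi / M\<close>. Angles beyond \<open>pi\<close> are reflected into \<open>[0, pi]\<close>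
  by \<open>x\<close> to \<open>2 * pi - x\<close>. This makes the weights below
  nonnegative.\<close>

lemma cos_odd_le:
  assumes "l < M"
  shows "cos (real (2 * l + 1) * pi / real M) \<le> cos (pi / real M)"
proof (cases "2 * l + 1 \<le> M")
  case True
  show ?thesis
  proof (rule cos_monotone_0_pi_le)
    show "pi / real M \<le> real (2 * l + 1) * pi / real M"
      by (rule divide_right_mono) (auto intro: mult_left_mono)
    have "real (2 * l + 1) * pi \<le> real M * pi"
      using True by (intro mult_right_mono) auto
    then show "real (2 * l + 1) * pi / real M \<le> pi"
      using assms by (simp add: divide_simps mult.commute)
  qed simp
next
  case False
  define x where "x = real (2 * l + 1) * pi / real M"
  have M: "0 < real M" using assms by simp
  have "cos x = cos (2 * pi - x)"
    by (simp add: cos_diff)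
  also have "\<dots> \<le> cos (pi / real M)"
  proof (rule cos_monotone_0_pi_le)
    have "real (2 * l + 1) * pi \<le> (2 * real M - 1) * pi"
      using assms by (intro mult_right_mono) auto
    then show "pi / real M \<le> 2 * pi - x"
      using M by (simp add: x_def field_simps)
    have "real M * pi \<le> real (2 * l + 1) * pi"
      using False by (intro mult_right_mono) auto
    then show "2 * pi - x \<le> pi"
      using M by (simp add: x_def field_simps)
  qed simp
  finally show ?thesis by (simp add: x_def)
qed

text \<open>
  The weights \<open>cos (\<pi> / M) - cos \<theta>\<close> at the \<open>M\<close>-th roots of \<open>-1\<close>, where \<open>M = N + 2\<close>, are
  nonnegative, and of all Fourier coefficients of order up to \<open>N\<close> only those of order 0 and 1
  survive.
\<close>

lemma Fejer_coefficient_bound: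
  fixes c :: "nat \<Rightarrow> complex"
  assumes N: "1 \<le> N"
    and pos: "\<And>z. cmod z = 1 \<Longrightarrow> 0 \<le> b + Re (\<Sum>i=1..N. c i * z ^ i)"
  shows "Re (c 1) \<le> 2 * b * cos (pi / (real N + 2))"
proof -
  \<comment> \<open>With \<open>M = N + 2\<close> all orders up to \<open>N + 1\<close> stay below
    \<open>M\<close>, so multiplying \<open>\<zeta> l ^ i\<close> by a weight, which shifts
    \<open>i\<close> by one, never reaches the order \<open>M\<close>.\<close>
  define M where "M = N + 2"
  define \<zeta> where "\<zeta> l = cis (real (2 * l + 1) * pi / real M)" for l
  define w where "w l = cos (pi / real M) - Re (\<zeta> l)" for l
  have \<zeta>0: "(\<Sum>l<M. \<zeta> l ^ j) = 0" if "0 < j" "j < M" for j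
    unfolding \<zeta>_def by (rule sum_cis_odd_power[OF that])
  have unit: "\<zeta> l * cnj (\<zeta> l) = 1" for l
    by (simp add: \<zeta>_def complex_norm_square[symmetric])
  have w: "complex_of_real (w l) = complex_of_real (cos (pi / real M)) - (\<zeta> l + cnj (\<zeta> l)) / 2" for l
    by (simp add: w_def complex_add_cnj)
  \<comment> \<open>On the unit circle the conjugate is the inverse, so the cosine in the weight
    moves the exponent up and down by one.\<close>
  have w_power: "complex_of_real (w l) * \<zeta> l ^ i =
      complex_of_real (cos (pi / real M)) * \<zeta> l ^ i - \<zeta> l ^ (i + 1) / 2 - \<zeta> l ^ (i - 1) / 2"
    if "1 \<le> i" for i l
  proof -
    have "\<zeta> l ^ i = \<zeta> l * \<zeta> l ^ (i - 1)"
      using that by (simp flip: power_Suc)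
    then have "cnj (\<zeta> l) * \<zeta> l ^ i = \<zeta> l ^ (i - 1)"
      using unit[of l] by (metis mult.assoc mult.commute mult_1)
    then show ?thesis by (simp add: w field_simps)
  qed
  have sum0: "(\<Sum>l<M. w l) = real M * cos (pi / real M)"
  proof -
    have "(\<Sum>l<M. Re (\<zeta> l)) = Re (\<Sum>l<M. \<zeta> l ^ 1)" by simp
    also have "\<dots> = 0" by (subst \<zeta>0) (simp_all add: M_def)
    finally show ?thesis by (simp add: w_def sum_subtractf)
  qed
  have sum1: "(\<Sum>l<M. complex_of_real (w l) * \<zeta> l ^ i) = (if i = 1 then - of_nat M / 2 else 0)"
    if "1 \<le> i" "i \<le> N" for i
  proof -
    have "(\<Sum>l<M. complex_of_real (w l) * \<zeta> l ^ i) =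
        complex_of_real (cos (pi / real M)) * (\<Sum>l<M. \<zeta> l ^ i) - (\<Sum>l<M. \<zeta> l ^ (i + 1)) / 2
        - (\<Sum>l<M. \<zeta> l ^ (i - 1)) / 2"
      by (simp only: w_power[OF that(1)] sum_subtractf sum_distrib_left sum_divide_distrib)
    also have "(\<Sum>l<M. \<zeta> l ^ i) = 0"
      using that by (intro \<zeta>0) (auto simp: M_def)
    also have "(\<Sum>l<M. \<zeta> l ^ (i + 1)) = 0"
      using that by (intro \<zeta>0) (auto simp: M_def)
    also have "(\<Sum>l<M. \<zeta> l ^ (i - 1)) = (if i = 1 then of_nat M else 0)"
    proof (cases "i = 1")
      case False
      then have "(\<Sum>l<M. \<zeta> l ^ (i - 1)) = 0"
        using that by (intro \<zeta>0) (auto simp: M_def)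
      with False show ?thesis by simp
    qed simp
    finally show ?thesis by simp
  qed
  \<comment> \<open>Weighted average of the positivity hypothesis over the roots: \<open>b\<close>
    receives \<open>M * cos (pi / M)\<close>, \<open>c 1\<close> receives \<open>- M / 2\<close>,
    and the other coefficients receive 0.\<close>
  have "0 \<le> (\<Sum>l<M. w l * (b + Re (\<Sum>i=1..N. c i * \<zeta> l ^ i)))"
    using cos_odd_le by (intro sum_nonneg mult_nonneg_nonneg pos) (auto simp: w_def \<zeta>_def)
  also have "\<dots> = b * (\<Sum>l<M. w l) + Re (\<Sum>l<M. complex_of_real (w l) * (\<Sum>i=1..N. c i * \<zeta> l ^ i))"
    by (simp add: distrib_left sum.distrib sum_distrib_left mult.commute)
  also have "(\<Sum>l<M. complex_of_real (w l) * (\<Sum>i=1..N. c i * \<zeta> l ^ i)) =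
      (\<Sum>i=1..N. c i * (\<Sum>l<M. complex_of_real (w l) * \<zeta> l ^ i))"
    unfolding sum_distrib_left by (subst sum.swap) (simp add: mult.left_commute)
  also have "\<dots> = (\<Sum>i=1..N. c i * (if i = 1 then - of_nat M / 2 else 0))"
    by (intro sum.cong refl) (simp only: sum1 atLeastAtMost_iff)
  also have "\<dots> = (\<Sum>i=1..N. if i = 1 then - c 1 * of_nat M / 2 else 0)"
    by (intro sum.cong) auto
  also have "\<dots> = - c 1 * of_nat M / 2"
    using N by (subst sum.delta) auto
  also have "Re \<dots> = - Re (c 1) * real M / 2"
    by simp
  finally have "0 \<le> real M * (2 * b * cos (pi / real M) - Re (c 1))"
    unfolding sum0 by (simp add: field_simps)
  then have "Re (c 1) \<le> 2 * b * cos (pi / real M)"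
    by (simp add: zero_le_mult_iff M_def)
  then show ?thesis by (simp add: M_def add.commute)
qed


section \<open>Sums over words\<close>

lemma sum_words_le:
  "(\<Sum>\<alpha> | length \<alpha> \<le> L. g \<alpha>) = (\<Sum>k=0..L. \<Sum>\<alpha>\<in>words k. g \<alpha>)"
  for g :: "'n::finite list \<Rightarrow> 'b::comm_monoid_add"
proof -
  have "{\<alpha> :: 'n list. length \<alpha> \<le> L} = (\<Union>k\<in>{0..L}. words k)" by auto
  then show ?thesis by (simp only:) (rule sum.UNION_disjoint, auto)
qed

lemma finite_words_le [simp]: "finite {\<alpha> :: 'n::finite list. length \<alpha> \<le> L}"
  using finite_lists_length_le[of "UNIV :: 'n set" L] by simp

lemma sum_words_add:
  "(\<Sum>\<alpha>\<in>words (k + l). g \<alpha>) = (\<Sum>\<beta>\<in>words k. \<Sum>\<gamma>\<in>words l. g (\<beta> @ \<gamma>))"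
  for g :: "'n::finite list \<Rightarrow> 'b::comm_monoid_add"
  by (induction k arbitrary: g) (simp_all add: words_0 sum_words_Suc)

lemma sum_scalar_word_square:
  fixes r :: "real ^ 'n"
  shows "(\<Sum>\<alpha>\<in>words k. (scalar_word r \<alpha>)\<^sup>2) = (norm r ^ k)\<^sup>2"
proof (induction k)
  case (Suc k)
  have "(norm r)\<^sup>2 = (\<Sum>i\<in>UNIV. (r $ i)\<^sup>2)"
    by (simp add: norm_vec_def L2_set_def sum_nonneg)
  then show ?case
    using Suc by (simp add: sum_words_Suc scalar_word_def power_mult_distrib
        flip: sum_product sum_distrib_left sum_distrib_right)
qed (simp add: words_0 scalar_word_def)


section \<open>Tensor powers and the test vectors\<close>

text \<open>
  The coordinates of the sum of all tensor powers of the vector of degree \<open>k\<close> with coordinates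
  \<open>v\<close>.
\<close>

function tensor_powers :: "nat \<Rightarrow> ('n list \<Rightarrow> complex) \<Rightarrow> 'n list \<Rightarrow> complex" where
  "tensor_powers k v \<alpha> = (if k = 0 \<or> length \<alpha> < k then if \<alpha> = [] then 1 else 0
     else v (take k \<alpha>) * tensor_powers k v (drop k \<alpha>))"
  by pat_completeness auto
termination
  by (relation "Wellfounded.measure (\<lambda>(k, v, \<alpha>). length \<alpha>)") auto

declare tensor_powers.simps [simp del]

lemma tensor_powers_Nil [simp]: "tensor_powers k v [] = 1"
  by (subst tensor_powers.simps) auto

context
  fixes k :: nat
  assumes k: "0 < k"
begin

lemma tensor_powers_append_block:
  "length \<beta> = k \<Longrightarrow> tensor_powers k v (\<beta> @ \<gamma>) = v \<beta> * tensor_powers k v \<gamma>"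
  using k by (subst tensor_powers.simps) auto

lemma tensor_powers_block: "length \<beta> = k \<Longrightarrow> tensor_powers k v \<beta> = v \<beta>"
  using tensor_powers_append_block[of \<beta> v "[]"] by simp

text \<open>Stripping blocks of \<open>k\<close> letters leaves a nonempty remainder shorter than
  \<open>k\<close>, where the recursion returns 0.\<close>

lemma tensor_powers_not_dvd:
  "\<not> k dvd length \<alpha> \<Longrightarrow> tensor_powers k v \<alpha> = 0"
proof (induction "length \<alpha>" arbitrary: \<alpha> rule: less_induct)
  case less
  show ?case
  proof (cases "length \<alpha> < k")
    case True
    then show ?thesis using less.prems by (subst tensor_powers.simps) auto
  next
    case False
    then have "\<not> k dvd length (drop k \<alpha>)"
      using less.prems by (metis dvd_diffD dvd_refl length_drop not_less)
    moreover have "length (drop k \<alpha>) < length \<alpha>" using False k by simp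
    ultimately show ?thesis
      using less.hyps False by (subst tensor_powers.simps) auto
  qed
qed

lemma tensor_powers_append:
  "length \<beta> = i * k \<Longrightarrow> tensor_powers k v (\<beta> @ \<gamma>) = tensor_powers k v \<beta> * tensor_powers k v \<gamma>"
proof (induction i arbitrary: \<beta>)
  case (Suc i)
  have "tensor_powers k v ((take k \<beta> @ drop k \<beta>) @ \<gamma>) =
      v (take k \<beta>) * tensor_powers k v (drop k \<beta> @ \<gamma>)"
    unfolding append_assoc using Suc.prems by (intro tensor_powers_append_block) simp
  also have "\<dots> = v (take k \<beta>) * tensor_powers k v (drop k \<beta>) * tensor_powers k v \<gamma>"
    using Suc.prems by (subst Suc.IH) simp_all
  also have "\<dots> = tensor_powers k v (take k \<beta> @ drop k \<beta>) * tensor_powers k v \<gamma>"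
    using Suc.prems by (subst tensor_powers_append_block) simp_all
  finally show ?case by simp
qed simp

text \<open>The \<open>i\<close>-th tensor power is homogeneous of degree \<open>i\<close>. Rotating
  \<open>v\<close> by a unimodular \<open>z\<close> thus produces a polynomial in one
  variable.\<close>

lemma tensor_powers_scale:
  "length \<beta> = i * k \<Longrightarrow> tensor_powers k (\<lambda>\<alpha>. z * v \<alpha>) \<beta> = z ^ i * tensor_powers k v \<beta>"
proof (induction i arbitrary: \<beta>)
  case (Suc i)
  have "tensor_powers k u \<beta> = u (take k \<beta>) * tensor_powers k u (drop k \<beta>)" for u
    using tensor_powers_append_block[of "take k \<beta>" u "drop k \<beta>"] Suc.prems by simp
  then show ?case using Suc by simp
qed simp

text \<open>Norms of tensor products multiply, so all tensor powers of a unit vector are unit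
  vectors.\<close>

lemma sum_tensor_powers_square:
  fixes v :: "'n::finite list \<Rightarrow> complex"
  assumes v: "(\<Sum>\<beta>\<in>words k. (cmod (v \<beta>))\<^sup>2) = 1"
  shows "(\<Sum>\<alpha>\<in>words d. (cmod (tensor_powers k v \<alpha>))\<^sup>2) = (if k dvd d then 1 else 0)"
proof (cases "k dvd d")
  case True
  then obtain j where d: "d = j * k" by (metis dvdE mult.commute)
  have "(\<Sum>\<alpha>\<in>words (j * k). (cmod (tensor_powers k v \<alpha>))\<^sup>2) = 1"
  proof (induction j)
    case (Suc j)
    have "(\<Sum>\<alpha>\<in>words (k + j * k). (cmod (tensor_powers k v \<alpha>))\<^sup>2) =
        (\<Sum>\<beta>\<in>words k. \<Sum>\<gamma>\<in>words (j * k). (cmod (v \<beta>))\<^sup>2 * (cmod (tensor_powers k v \<gamma>))\<^sup>2)"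
      by (simp add: sum_words_add tensor_powers_append_block norm_mult power_mult_distrib)
    then show ?case using v Suc by (simp flip: sum_distrib_left)
  qed (simp add: words_0)
  then show ?thesis using True d by simp
qed (auto simp: tensor_powers_not_dvd)

end

text \<open>For \<open>0 < k\<close> the cutoff \<open>L = J * k\<close> keeps exactly the tensor
  powers of exponents 0 to \<open>J\<close>.\<close>

lift_definition test_vector :: "nat \<Rightarrow> ('n::finite list \<Rightarrow> complex) \<Rightarrow> nat \<Rightarrow> 'n fock" is
  "\<lambda>k v L \<alpha>. if length \<alpha> \<le> L then tensor_powers k v \<alpha> else 0"
proof -
  fix k L and v :: "'n list \<Rightarrow> complex"
  show "summable (\<lambda>d. \<Sum>\<alpha>\<in>words d. (cmod (if length \<alpha> \<le> L then tensor_powers k v \<alpha> else 0))\<^sup>2)"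
    by (rule summable_finite[of "{0..L}"]) auto
qed

section \<open>Pairings of creation words with test vectors\<close>

lemma coord_creation_word:
  "coord (op_word creation \<alpha> \<phi>) \<gamma> =
     (if take (length \<alpha>) \<gamma> = \<alpha> then coord \<phi> (drop (length \<alpha>) \<gamma>) else 0)"
proof (induction \<alpha> arbitrary: \<gamma>)
  case (Cons i \<alpha>)
  then show ?case
    by (cases \<gamma>) (auto simp: op_word_def creation.rep_eq tensor.rep_eq axis_def)
qed (simp add: op_word_def)

lemma cinner_finite_support:
  assumes "\<And>\<alpha>. L < length \<alpha> \<Longrightarrow> coord \<psi> \<alpha> = 0"
  shows "cinner \<phi> \<psi> = (\<Sum>\<alpha> | length \<alpha> \<le> L. coord \<phi> \<alpha> * cnj (coord \<psi> \<alpha>))"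
  unfolding cinner_fock_def sum_words_le
  by (rule suminf_finite) (use assms in auto)

text \<open>The image of a creation word lives on the words with prefix \<open>\<alpha>\<close>;
  deleting that prefix reindexes the sum.\<close>

lemma cinner_creation_word:
  assumes "\<And>\<alpha>. L < length \<alpha> \<Longrightarrow> coord \<psi> \<alpha> = 0"
  shows "cinner (op_word creation \<alpha> \<phi>) \<psi> =
    (\<Sum>\<gamma> | length \<gamma> \<le> L. coord \<phi> \<gamma> * cnj (coord \<psi> (\<alpha> @ \<gamma>)))"
proof -
  have split: "length \<alpha> \<le> length \<gamma> \<and> \<alpha> @ drop (length \<alpha>) \<gamma> = \<gamma>" if "take (length \<alpha>) \<gamma> = \<alpha>" for \<gamma>
    using that by (metis append_take_drop_id length_append le_add1)
  have "cinner (op_word creation \<alpha> \<phi>) \<psi> =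
      (\<Sum>\<gamma> | length \<gamma> \<le> L. coord (op_word creation \<alpha> \<phi>) \<gamma> * cnj (coord \<psi> \<gamma>))"
    using assms by (rule cinner_finite_support)
  also have "\<dots> = (\<Sum>\<gamma> | length \<gamma> \<le> L \<and> take (length \<alpha>) \<gamma> = \<alpha>.
      coord \<phi> (drop (length \<alpha>) \<gamma>) * cnj (coord \<psi> \<gamma>))"
    by (intro sum.mono_neutral_cong_right) (auto simp: coord_creation_word)
  also have "\<dots> = (\<Sum>\<gamma> | length (\<alpha> @ \<gamma>) \<le> L. coord \<phi> \<gamma> * cnj (coord \<psi> (\<alpha> @ \<gamma>)))"
    by (rule sum.reindex_bij_witness[of _ "\<lambda>\<gamma>. \<alpha> @ \<gamma>" "drop (length \<alpha>)"])
      (auto simp: split)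
  \<comment> \<open>The added terms vanish since \<open>\<alpha> @ \<gamma>\<close> is then longer
    than \<open>L\<close>. The range no longer depends on \<open>\<alpha>\<close>.\<close>
  also have "\<dots> = (\<Sum>\<gamma> | length \<gamma> \<le> L. coord \<phi> \<gamma> * cnj (coord \<psi> (\<alpha> @ \<gamma>)))"
    by (rule sum.mono_neutral_left) (auto simp: assms)
  finally show ?thesis .
qed

text \<open>If \<open>length \<alpha> = i * k\<close>, the operator matches the tensor power of
  exponent \<open>j\<close> with that of exponent \<open>i + j\<close>. Each \<open>j\<close> with
  \<open>i + j \<le> J\<close> contributes the same amount, and there are \<open>J + 1 - i\<close>
  of them; truncated subtraction gives 0 when \<open>i > J\<close>.\<close>

lemma cinner_creation_word_test_vector:
  fixes v :: "'n::finite list \<Rightarrow> complex" and J :: nat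
  assumes k: "0 < k" and v: "(\<Sum>\<beta>\<in>words k. (cmod (v \<beta>))\<^sup>2) = 1"
  defines "\<phi> \<equiv> test_vector k v (J * k)"
  shows "cinner (op_word creation \<alpha> \<phi>) \<phi> =
    cnj (tensor_powers k v \<alpha>) * of_nat (J + 1 - length \<alpha> div k)"
proof (cases "k dvd length \<alpha>")
  case False
  \<comment> \<open>The lengths of \<open>\<gamma>\<close> and \<open>\<alpha> @ \<gamma>\<close>
    cannot both be multiples of \<open>k\<close>.\<close>
  have 0: "coord \<phi> \<gamma> * cnj (coord \<phi> (\<alpha> @ \<gamma>)) = 0" for \<gamma>
    using tensor_powers_not_dvd[OF k, of \<gamma> v] tensor_powers_not_dvd[OF k, of "\<alpha> @ \<gamma>" v] False
    by (cases "k dvd length \<gamma>") (auto simp: \<phi>_def test_vector.rep_eq dvd_add_left_iff)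
  have "cinner (op_word creation \<alpha> \<phi>) \<phi> =
      (\<Sum>\<gamma> | length \<gamma> \<le> J * k. coord \<phi> \<gamma> * cnj (coord \<phi> (\<alpha> @ \<gamma>)))"
    by (rule cinner_creation_word) (simp add: \<phi>_def test_vector.rep_eq)
  then show ?thesis
    by (simp only: 0 sum.neutral_const tensor_powers_not_dvd[OF k False]) simp
next
  case True
  then obtain i where i: "length \<alpha> = i * k" by (metis dvdE mult.commute)
  have "cinner (op_word creation \<alpha> \<phi>) \<phi> =
      (\<Sum>d=0..J * k. \<Sum>\<gamma>\<in>words d. coord \<phi> \<gamma> * cnj (coord \<phi> (\<alpha> @ \<gamma>)))"
    unfolding sum_words_le[symmetric]
    by (rule cinner_creation_word) (simp add: \<phi>_def test_vector.rep_eq)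
  also have "\<dots> = (\<Sum>d=0..J * k. if i * k + d \<le> J * k \<and> k dvd d then cnj (tensor_powers k v \<alpha>) else 0)"
  proof (intro sum.cong refl)
    fix d assume d: "d \<in> {0..J * k}"
    have "(\<Sum>\<gamma>\<in>words d. coord \<phi> \<gamma> * cnj (coord \<phi> (\<alpha> @ \<gamma>))) =
        (\<Sum>\<gamma>\<in>words d. if i * k + d \<le> J * k then
          cnj (tensor_powers k v \<alpha>) * complex_of_real ((cmod (tensor_powers k v \<gamma>))\<^sup>2) else 0)"
      using d by (intro sum.cong refl)
        (auto simp: \<phi>_def test_vector.rep_eq i tensor_powers_append[OF k i] complex_norm_square
          simp del: of_real_power)
    also have "\<dots> = (if i * k + d \<le> J * k then cnj (tensor_powers k v \<alpha>) *
        complex_of_real (\<Sum>\<gamma>\<in>words d. (cmod (tensor_powers k v \<gamma>))\<^sup>2) else 0)"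
      by (simp add: sum_distrib_left)
    finally show "(\<Sum>\<gamma>\<in>words d. coord \<phi> \<gamma> * cnj (coord \<phi> (\<alpha> @ \<gamma>))) =
        (if i * k + d \<le> J * k \<and> k dvd d then cnj (tensor_powers k v \<alpha>) else 0)"
      by (simp add: sum_tensor_powers_square[OF k v])
  qed
  also have "\<dots> = of_nat (card {d \<in> {0..J * k}. i * k + d \<le> J * k \<and> k dvd d}) * cnj (tensor_powers k v \<alpha>)"
    by (simp add: sum.If_cases Int_def)
  also have "{d \<in> {0..J * k}. i * k + d \<le> J * k \<and> k dvd d} = (\<lambda>j. j * k) ` {..<J + 1 - i}"
  proof (intro equalityI subsetI)
    fix d assume d: "d \<in> {d \<in> {0..J * k}. i * k + d \<le> J * k \<and> k dvd d}"
    then obtain j where "d = j * k" by (metis (no_types, lifting) dvdE mem_Collect_eq mult.commute)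
    with d have "(i + j) * k \<le> J * k" by (simp add: distrib_right)
    then show "d \<in> (\<lambda>j. j * k) ` {..<J + 1 - i}" using k \<open>d = j * k\<close> by auto
  next
    fix d assume "d \<in> (\<lambda>j. j * k) ` {..<J + 1 - i}"
    then obtain j where "d = j * k" "j < J + 1 - i" by blast
    then have "d = j * k" "i + j \<le> J" by auto
    moreover from this have "(i + j) * k \<le> J * k" by (intro mult_right_mono) auto
    ultimately show "d \<in> {d \<in> {0..J * k}. i * k + d \<le> J * k \<and> k dvd d}"
      by (simp add: distrib_right)
  qed
  also have "card \<dots> = J + 1 - i"
    using k by (subst card_image) (auto simp: inj_on_def)
  finally show ?thesis using k by (simp add: i)
qed


section \<open>The coefficient estimate\<close>

lemma cinner_sum_left: "cinner (\<Sum>i\<in>A. f i) y = (\<Sum>i\<in>A. cinner (f i) y)"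
  for y :: "'a::complex_inner"
proof -
  have "cinner 0 y = 0" using cinner_add_left[of 0 0 y] by simp
  then show ?thesis by (induction A rule: infinite_finite_induct) (simp_all add: cinner_add_left)
qed

lemma cinner_self: "cinner x x = complex_of_real ((norm x)\<^sup>2)"
  for x :: "'a::complex_inner"
proof (rule complex_eqI)
  show "Im (cinner x x) = Im (complex_of_real ((norm x)\<^sup>2))"
    using cinner_commute[of x x] by (simp add: complex_eq_iff)
qed (simp add: power2_norm_eq_inner inner_eq_Re_cinner)

lemma scaleC_sum_right: "c *\<^sub>C (\<Sum>i\<in>A. f i) = (\<Sum>i\<in>A. c *\<^sub>C f i)"
  for f :: "_ \<Rightarrow> 'a::complex_inner"
  by (rule linear_sum[OF bounded_linear.linear[OF bounded_linear_scaleC]])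

lemma clinear_op_word: "(\<And>i. clinear_op (T i)) \<Longrightarrow> clinear_op (op_word T \<alpha>)"
  by (induction \<alpha>) (simp_all add: op_word_def clinear_op_def)

lemma clinear_op_combination:
  "(\<And>i. i \<in> A \<Longrightarrow> clinear_op (F i)) \<Longrightarrow> clinear_op (\<Sum>i\<in>A. a i *\<^sub>C F i)"
  by (simp add: clinear_op_def blinfun.sum_left scaleC_blinfun.rep_eq scaleC_sum_right
      scaleC_scaleC mult.commute)

text \<open>The quadratic form of the adjoint is the conjugate of that of \<open>A\<close>, so the
  form of \<open>Re_op A\<close> is the real part of the form of \<open>A\<close>.\<close>

lemma Re_op_le_id_iff:
  fixes A :: "'a::chilbert_space \<Rightarrow>\<^sub>L 'a"
  assumes "clinear_op A"
  shows "op_le (Re_op A) id_blinfun \<longleftrightarrow> (\<forall>x. Re (cinner (A x) x) \<le> (norm x)\<^sup>2)"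
proof -
  have eq: "cinner ((id_blinfun - Re_op A) x) x = complex_of_real ((norm x)\<^sup>2 - Re (cinner (A x) x))" for x
  proof -
    have "cinner (cadjoint A x) x = cnj (cinner (A x) x)"
      by (metis cinner_cadjoint[OF assms] cinner_commute)
    then have *: "cinner (A x + cadjoint A x) x = complex_of_real (2 * Re (cinner (A x) x))"
      by (simp add: cinner_add_left complex_add_cnj)
    have "(id_blinfun - Re_op A) x = x + complex_of_real (- 1 / 2) *\<^sub>C (A x + cadjoint A x)"
      unfolding scaleC_of_real by (simp add: Re_op_def blinfun.diff_left blinfun.scaleR_left blinfun.add_left)
    then have "cinner ((id_blinfun - Re_op A) x) x =
        cinner x x + complex_of_real (- 1 / 2) * cinner (A x + cadjoint A x) x"
      by (simp only: cinner_add_left[of x] cinner_scaleC_left)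
    also have "\<dots> = complex_of_real ((norm x)\<^sup>2 - Re (cinner (A x) x))"
      unfolding * cinner_self by simp
    finally show ?thesis .
  qed
  show ?thesis by (simp only: op_le_def eq nonneg_Reals_of_real_iff diff_ge_0_iff_ge)
qed

lemma sum_multiples_le:
  fixes g :: "nat \<Rightarrow> 'b::comm_monoid_add"
  assumes k: "0 < k" and g: "\<And>d. \<not> k dvd d \<Longrightarrow> g d = 0"
  shows "(\<Sum>d=0..n. g d) = (\<Sum>i=0..n div k. g (i * k))"
proof -
  have "(\<Sum>i=0..n div k. g (i * k)) = sum g ((\<lambda>i. i * k) ` {0..n div k})"
    using k by (subst sum.reindex) (auto simp: inj_on_def)
  also have "\<dots> = (\<Sum>d=0..n. g d)"
  proof (rule sum.mono_neutral_left)
    show "(\<lambda>i. i * k) ` {0..n div k} \<subseteq> {0..n}"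
      using k by (auto simp: less_eq_div_iff_mult_less_eq)
    show "\<forall>d\<in>{0..n} - (\<lambda>i. i * k) ` {0..n div k}. g d = 0"
    proof
      fix d assume d: "d \<in> {0..n} - (\<lambda>i. i * k) ` {0..n div k}"
      have "\<not> k dvd d"
      proof
        assume "k dvd d"
        then have "d = d div k * k" by simp
        moreover have "d div k \<le> n div k" using d by (simp add: div_le_mono)
        ultimately show False using d by (metis DiffD2 atLeastAtMost_iff imageI zero_le)
      qed
      then show "g d = 0" by (rule g)
    qed
  qed simp
  finally show ?thesis by simp
qed

section \<open>Consequences of Re p(S) \<le> I for the coefficients\<close>

context
  fixes a :: "'n::finite list \<Rightarrow> complex" and n :: nat
  assumes le: "op_le (Re_op (\<Sum>\<alpha> | length \<alpha> \<le> n. a \<alpha> *\<^sub>C op_word creation \<alpha>)) id_blinfun"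
begin

text \<open>The quadratic form of p(S) at the test vector only sees word lengths
  \<open>i * k\<close>, with weights \<open>J + 1 - i\<close>; the right side is the squared norm of
  the test vector.\<close>

lemma test_vector_inequality:
  assumes k: "0 < k" and v: "(\<Sum>\<beta>\<in>words k. (cmod (v \<beta>))\<^sup>2) = 1"
  shows "Re (\<Sum>i=0..n div k. (\<Sum>\<alpha>\<in>words (i * k). a \<alpha> * cnj (tensor_powers k v \<alpha>)) * of_nat (J + 1 - i))
    \<le> real J + 1"
proof -
  define \<phi> where "\<phi> = test_vector k v (J * k)"
  define P :: "'n fock \<Rightarrow>\<^sub>L 'n fock" where "P = (\<Sum>\<alpha> | length \<alpha> \<le> n. a \<alpha> *\<^sub>C op_word creation \<alpha>)"
  have pair: "cinner (op_word creation \<alpha> \<phi>) \<phi> =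
    cnj (tensor_powers k v \<alpha>) * of_nat (J + 1 - length \<alpha> div k)" for \<alpha>
    unfolding \<phi>_def by (rule cinner_creation_word_test_vector[OF k v])
  have "clinear_op P"
    unfolding P_def by (intro clinear_op_combination clinear_op_word clinear_creation)
  then have *: "Re (cinner (P \<phi>) \<phi>) \<le> (norm \<phi>)\<^sup>2"
    using le by (simp add: Re_op_le_id_iff flip: P_def)
  \<comment> \<open>The empty word acts as the identity, so the pairing formula also yields the
    norm.\<close>
  have "complex_of_real ((norm \<phi>)\<^sup>2) = cinner (op_word creation [] \<phi>) \<phi>"
    by (simp only: op_word_def) (simp add: cinner_self)
  also have "\<dots> = complex_of_real (real J + 1)"
    unfolding pair by simp
  finally have norm: "(norm \<phi>)\<^sup>2 = real J + 1"
    by (simp only: of_real_eq_iff)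
  have "cinner (P \<phi>) \<phi> =
      (\<Sum>\<alpha> | length \<alpha> \<le> n. a \<alpha> * cnj (tensor_powers k v \<alpha>) * of_nat (J + 1 - length \<alpha> div k))"
    by (simp add: P_def blinfun.sum_left scaleC_blinfun.rep_eq cinner_sum_left cinner_scaleC_left pair
        mult.assoc del: of_nat_diff)
  also have "\<dots> = (\<Sum>d=0..n. (\<Sum>\<alpha>\<in>words d. a \<alpha> * cnj (tensor_powers k v \<alpha>)) * of_nat (J + 1 - d div k))"
    by (simp add: sum_words_le sum_distrib_right)
  also have "\<dots> = (\<Sum>i=0..n div k.
      (\<Sum>\<alpha>\<in>words (i * k). a \<alpha> * cnj (tensor_powers k v \<alpha>)) * of_nat (J + 1 - i * k div k))"
    by (rule sum_multiples_le[OF k]) (simp add: tensor_powers_not_dvd[OF k])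
  finally show ?thesis using * norm k by simp
qed

text \<open>For \<open>J = 0\<close> the test vector is the vacuum, where the quadratic form of p(S)
  equals \<open>a []\<close>. The constant \<open>v\<close> is a unit vector of degree 1.\<close>

lemma constant_coefficient_le: "Re (a []) \<le> 1"
proof -
  define v where "v \<beta> = complex_of_real (1 / sqrt (real (card (words 1 :: 'n list set))))" for \<beta> :: "'n list"
  have "[undefined] \<in> (words 1 :: 'n list set)" by simp
  then have "card (words 1 :: 'n list set) \<noteq> 0" by (metis card_0_eq empty_iff finite_words)
  then have "(\<Sum>\<beta>\<in>words 1. (cmod (v \<beta>))\<^sup>2) = 1"
    by (simp add: v_def norm_divide power_divide)
  from test_vector_inequality[OF _ this, of 0]
  have "Re (\<Sum>i=0..n. (\<Sum>\<alpha>\<in>words i. a \<alpha> * cnj (tensor_powers 1 v \<alpha>)) * of_nat (1 - i)) \<le> 1"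
    by simp
  also have "(\<Sum>i=0..n. (\<Sum>\<alpha>\<in>words i. a \<alpha> * cnj (tensor_powers 1 v \<alpha>)) * of_nat (1 - i)) = a []"
    by (subst sum.atLeast_Suc_atMost) (simp_all add: words_0)
  finally show ?thesis .
qed

theorem coefficient_bound:
  assumes a0: "a [] \<in> \<real>\<^sub>\<ge>\<^sub>0" and k: "1 \<le> k" "k \<le> n"
  shows "L2_set (\<lambda>\<alpha>. cmod (a \<alpha>)) (words k) \<le> 2 * (1 - Re (a [])) * cos (pi / (real (n div k) + 2))"
    (is "?A \<le> ?B")
proof (cases "?A = 0")
  case True
  \<comment> \<open>Here \<open>v\<close> cannot be normalised, and only nonnegativity of the right
    side has to be shown.\<close>
  have "0 \<le> cos (pi / (real (n div k) + 2))"
    by (intro cos_ge_zero) (auto simp: field_simps intro: order_trans[of _ 0])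
  then show ?thesis using True constant_coefficient_le by simp
next
  case False
  \<comment> \<open>The normalised coefficients of degree \<open>k\<close>. The sign makes
    \<open>- c 1\<close> equal to the norm \<open>?A\<close>, the quantity that the Fejer bound
    estimates from above.\<close>
  define v where "v \<alpha> = - (a \<alpha> / of_real ?A)" for \<alpha>
  have sq: "(\<Sum>\<alpha>\<in>words k. (cmod (a \<alpha>))\<^sup>2) = ?A\<^sup>2"
    by (simp add: L2_set_def sum_nonneg)
  have v: "(\<Sum>\<beta>\<in>words k. (cmod (z * v \<beta>))\<^sup>2) = 1" if "cmod z = 1" for z
    using False that by (simp add: v_def norm_mult norm_divide power_divide sq flip: sum_divide_distrib)
  define c where "c i = (\<Sum>\<alpha>\<in>words (i * k). a \<alpha> * cnj (tensor_powers k v \<alpha>))" for i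
  have k0: "0 < k" and N: "1 \<le> n div k"
    using k by (auto simp: less_eq_div_iff_mult_less_eq)
  have c0: "c 0 = complex_of_real (Re (a []))"
    using a0 by (simp add: c_def words_0 complex_eq_iff complex_nonneg_Reals_iff)
  have "c 1 = (\<Sum>\<alpha>\<in>words k. a \<alpha> * cnj (v \<alpha>))"
    by (simp add: c_def tensor_powers_block[OF k0])
  also have "\<dots> = - complex_of_real ((\<Sum>\<alpha>\<in>words k. (cmod (a \<alpha>))\<^sup>2) / ?A)"
    by (simp add: v_def complex_norm_square sum_negf sum_divide_distrib flip: of_real_power)
  also have "\<dots> = - complex_of_real ?A"
    using False by (simp only: sq) (simp add: power2_eq_square)
  finally have c1: "c 1 = - complex_of_real ?A" .
  have J: "real J * ?A \<le> (real J + 1) * ?B" for J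
  proof -
    \<comment> \<open>Moving the term of order 0 to the right of the test inequality gives the
      constant \<open>(J + 1) * (1 - Re (a []))\<close>; the remaining terms form the trigonometric
      polynomial.\<close>
    have "Re (- c 1 * of_nat (J + 1 - 1)) \<le> 2 * ((real J + 1) * (1 - Re (a []))) * cos (pi / (real (n div k) + 2))"
    proof (rule Fejer_coefficient_bound[OF N, where c = "\<lambda>i. - c i * of_nat (J + 1 - i)"])
      fix z assume z: "cmod z = 1"
      \<comment> \<open>The pairing is antilinear in the test vector, so rotating \<open>v\<close>
        by \<open>cnj z\<close> yields powers of \<open>z\<close>.\<close>
      have "(\<Sum>\<alpha>\<in>words (i * k). a \<alpha> * cnj (tensor_powers k (\<lambda>\<beta>. cnj z * v \<beta>) \<alpha>)) = c i * z ^ i" for i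
        unfolding c_def sum_distrib_right
        by (intro sum.cong refl) (simp add: tensor_powers_scale[OF k0, of _ i] mult_ac)
      then have "Re (\<Sum>i=0..n div k. c i * z ^ i * of_nat (J + 1 - i)) \<le> real J + 1"
        using test_vector_inequality[OF k0 v[of "cnj z"], of J] z by simp
      then have "Re (c 0 * of_nat (J + 1) + (\<Sum>i=1..n div k. c i * z ^ i * of_nat (J + 1 - i))) \<le> real J + 1"
        by (subst (asm) sum.atLeast_Suc_atMost) simp_all
      then show "0 \<le> (real J + 1) * (1 - Re (a [])) + Re (\<Sum>i=1..n div k. - c i * of_nat (J + 1 - i) * z ^ i)"
        by (simp add: c0 sum_negf algebra_simps del: of_nat_diff)
    qed
    then show ?thesis by (simp add: c1[unfolded One_nat_def] algebra_simps)
  qed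
  \<comment> \<open>The index is shifted so that the division is by a positive number; the factor
    tends to 1.\<close>
  have "?A \<le> (1 + 1 / real (Suc J)) * ?B" for J
    using J[of "Suc J"] by (simp add: field_simps)
  moreover have "(\<lambda>J. (1 + 1 / real (Suc J)) * ?B) \<longlonglongrightarrow> (1 + 0) * ?B"
    by (intro tendsto_intros LIMSEQ_Suc lim_1_over_n)
  ultimately show ?thesis
    by (intro LIMSEQ_le_const[of "\<lambda>J. (1 + 1 / real (Suc J)) * ?B"]) auto
qed

end


section \<open>Row contractions\<close>

text \<open>A row operator has the norm of its adjoint column. With \<open>y\<close> the sum on the
  left, the squared norms of \<open>cadjoint (T i) y\<close> add up to \<open>inner (R y) y\<close>,
  and Cauchy-Schwarz bounds the squared norm of \<open>y\<close>, written as the sum of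
  \<open>inner (x i) (cadjoint (T i) y)\<close>.\<close>

lemma row_ball_bound:
  fixes T :: "'n::finite \<Rightarrow> 'a::chilbert_space \<Rightarrow>\<^sub>L 'a"
  assumes T: "T \<in> row_ball t"
  shows "norm (\<Sum>i\<in>UNIV. T i (x i)) \<le> t * L2_set (\<lambda>i. norm (x i)) UNIV"
proof -
  define y where "y = (\<Sum>i\<in>UNIV. T i (x i))"
  define R where "R = (\<Sum>i\<in>UNIV. T i o\<^sub>L cadjoint (T i))"
  have adj: "inner (T i u) w = inner u (cadjoint (T i) w)" for i u w
    using T cinner_cadjoint[of "T i" u w] by (simp add: row_ball_def inner_eq_Re_cinner)
  have R: "sqrt (norm R) \<le> t" using T by (simp add: row_ball_def R_def)
  have "(\<Sum>i\<in>UNIV. (norm (cadjoint (T i) y))\<^sup>2) = inner (R y) y"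
    by (simp add: R_def blinfun.sum_left inner_sum_left adj power2_norm_eq_inner)
  also have "\<dots> \<le> norm (R y) * norm y" by (rule norm_cauchy_schwarz)
  also have "\<dots> \<le> norm R * norm y * norm y" by (intro mult_right_mono norm_blinfun) simp
  also have "\<dots> = norm R * (norm y)\<^sup>2" by (simp add: power2_eq_square)
  finally have "sqrt (\<Sum>i\<in>UNIV. (norm (cadjoint (T i) y))\<^sup>2) \<le> sqrt (norm R * (norm y)\<^sup>2)"
    by (rule real_sqrt_le_mono)
  then have "L2_set (\<lambda>i. norm (cadjoint (T i) y)) UNIV \<le> sqrt (norm R) * norm y"
    by (simp add: L2_set_def real_sqrt_mult)
  also have "\<dots> \<le> t * norm y" using R by (intro mult_right_mono) auto
  finally have L2: "L2_set (\<lambda>i. norm (cadjoint (T i) y)) UNIV \<le> t * norm y" .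
  have "norm y * norm y = (\<Sum>i\<in>UNIV. inner (x i) (cadjoint (T i) y))"
    by (simp add: inner_sum_left adj flip: power2_eq_square power2_norm_eq_inner)
      (simp add: y_def power2_norm_eq_inner inner_sum_left adj)
  also have "\<dots> \<le> (\<Sum>i\<in>UNIV. \<bar>norm (x i)\<bar> * \<bar>norm (cadjoint (T i) y)\<bar>)"
    by (intro sum_mono) (simp add: norm_cauchy_schwarz)
  also have "\<dots> \<le> L2_set (\<lambda>i. norm (x i)) UNIV * L2_set (\<lambda>i. norm (cadjoint (T i) y)) UNIV"
    by (rule L2_set_mult_ineq)
  also have "\<dots> \<le> L2_set (\<lambda>i. norm (x i)) UNIV * (t * norm y)"
    by (intro mult_left_mono L2) simp
  finally have "norm y * norm y \<le> (t * L2_set (\<lambda>i. norm (x i)) UNIV) * norm y"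
    by (simp add: mult_ac)
  moreover have "0 \<le> t" using R order_trans real_sqrt_ge_zero norm_ge_zero by blast
  ultimately have "norm y \<le> t * L2_set (\<lambda>i. norm (x i)) UNIV"
    by (cases "norm y = 0") (auto simp: mult_le_cancel_right)
  then show ?thesis by (simp add: y_def)
qed

text \<open>Each first letter peeled off costs one factor \<open>t\<close>, and the nested Euclidean
  norms combine into the one over longer words.\<close>

lemma row_ball_word_bound:
  fixes T :: "'n::finite \<Rightarrow> 'a::chilbert_space \<Rightarrow>\<^sub>L 'a"
  assumes T: "T \<in> row_ball t" and t: "0 \<le> t"
  shows "norm (\<Sum>\<alpha>\<in>words k. op_word T \<alpha> (x \<alpha>)) \<le> t ^ k * L2_set (\<lambda>\<alpha>. norm (x \<alpha>)) (words k)"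
proof (induction k arbitrary: x)
  case 0
  show ?case by (simp add: words_0 op_word_def)
next
  case (Suc k)
  define y where "y i = (\<Sum>\<beta>\<in>words k. op_word T \<beta> (x (i # \<beta>)))" for i
  have y: "norm (y i) \<le> t ^ k * L2_set (\<lambda>\<beta>. norm (x (i # \<beta>))) (words k)" for i
    unfolding y_def by (rule Suc.IH)
  have "(\<Sum>\<alpha>\<in>words (Suc k). op_word T \<alpha> (x \<alpha>)) = (\<Sum>i\<in>UNIV. T i (y i))"
    by (simp add: sum_words_Suc y_def op_word_def blinfun.sum_right)
  also have "norm \<dots> \<le> t * L2_set (\<lambda>i. norm (y i)) UNIV"
    by (rule row_ball_bound[OF T])
  also have "\<dots> \<le> t * L2_set (\<lambda>i. t ^ k * L2_set (\<lambda>\<beta>. norm (x (i # \<beta>))) (words k)) UNIV"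
    by (intro mult_left_mono L2_set_mono y t) simp
  also have "\<dots> = t ^ Suc k * L2_set (\<lambda>i. L2_set (\<lambda>\<beta>. norm (x (i # \<beta>))) (words k)) UNIV"
    using t by (simp add: L2_set_right_distrib mult.assoc)
  also have "L2_set (\<lambda>i. L2_set (\<lambda>\<beta>. norm (x (i # \<beta>))) (words k)) UNIV = L2_set (\<lambda>\<alpha>. norm (x \<alpha>)) (words (Suc k))"
    by (simp add: L2_set_def sum_words_Suc sum_nonneg)
  finally show ?case .
qed

lemma norm_word_combination_le:
  fixes T :: "'n::finite \<Rightarrow> 'a::chilbert_space \<Rightarrow>\<^sub>L 'a"
  assumes T: "T \<in> row_ball t" and t: "0 \<le> t"
  shows "norm (\<Sum>\<alpha>\<in>words k. c \<alpha> *\<^sub>R op_word T \<alpha>) \<le> t ^ k * L2_set c (words k)"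
proof (rule norm_blinfun_bound)
  fix x
  have "(\<Sum>\<alpha>\<in>words k. c \<alpha> *\<^sub>R op_word T \<alpha>) x = (\<Sum>\<alpha>\<in>words k. op_word T \<alpha> (c \<alpha> *\<^sub>R x))"
    by (simp add: blinfun.sum_left blinfun.scaleR_left blinfun.scaleR_right)
  also have "norm \<dots> \<le> t ^ k * L2_set (\<lambda>\<alpha>. norm (c \<alpha> *\<^sub>R x)) (words k)"
    by (rule row_ball_word_bound[OF T t])
  also have "L2_set (\<lambda>\<alpha>. norm (c \<alpha> *\<^sub>R x)) (words k) = L2_set c (words k) * norm x"
    by (simp add: L2_set_def power_mult_distrib real_sqrt_mult flip: sum_distrib_right)
  finally show "norm ((\<Sum>\<alpha>\<in>words k. c \<alpha> *\<^sub>R op_word T \<alpha>) x) \<le> t ^ k * L2_set c (words k) * norm x"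
    by (simp add: mult.assoc)
qed (use t in simp)


section \<open>The radii\<close>

text \<open>The left side of the equation for the radius, with the integer part written as natural
  number division.\<close>

definition radius_poly :: "nat \<Rightarrow> real \<Rightarrow> real" where
  "radius_poly m t = (\<Sum>k=1..m-1. t ^ k * cos (pi / (real ((m - 1) div k) + 2)))"

lemma radius_eq_iff: "radius_eq m t \<longleftrightarrow> radius_poly m t = 1/2"
  by (simp add: radius_eq_def radius_poly_def floor_divide_of_nat_eq)

lemma cos_pi_div_mono:
  assumes "0 \<le> x" "x \<le> y"
  shows "cos (pi / (x + 2)) \<le> cos (pi / (y + 2))"
  by (rule cos_monotone_0_pi_le) (use assms in \<open>auto simp: field_simps intro: frac_le\<close>)

text \<open>The smallest case is the angle \<open>pi / 3\<close>.\<close>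

lemma cos_pi_div_ge_half:
  assumes "1 \<le> x"
  shows "1/2 \<le> cos (pi / (x + 2))"
  using cos_pi_div_mono[of 1 x] assms by (simp add: cos_60)

lemma radius_weight_ge_half:
  assumes "k \<in> {1..m-1}"
  shows "1/2 \<le> cos (pi / (real ((m - 1) div k) + 2))"
  using assms by (intro cos_pi_div_ge_half) (auto simp: less_eq_div_iff_mult_less_eq)

lemma radius_poly_strict_mono:
  assumes "2 \<le> m" "0 \<le> s" "s < t"
  shows "radius_poly m s < radius_poly m t"
  unfolding radius_poly_def
proof (rule sum_strict_mono)
  fix k assume k: "k \<in> {1..m-1}"
  then show "s ^ k * cos (pi / (real ((m - 1) div k) + 2)) < t ^ k * cos (pi / (real ((m - 1) div k) + 2))"
    using assms radius_weight_ge_half[OF k] by (intro mult_strict_right_mono power_strict_mono) auto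
qed (use assms in auto)

text \<open>Intermediate value theorem on \<open>[0, 1]\<close> for existence, strict monotonicity
  for uniqueness.\<close>

lemma ex1_radius:
  assumes m: "2 \<le> m"
  shows "\<exists>!t. 0 < t \<and> radius_eq m t" and "radius m \<in> {0<..1}" and "radius_poly m (radius m) = 1/2"
proof -
  have "continuous_on {0..1} (radius_poly m)"
    unfolding radius_poly_def by (intro continuous_intros)
  moreover have "radius_poly m 0 = 0"
    unfolding radius_poly_def by (intro sum.neutral) auto
  moreover have "1/2 \<le> radius_poly m 1"
  proof -
    have nonneg: "0 \<le> cos (pi / (real ((m - 1) div k) + 2))" if "k \<in> {1..m-1}" for k
      using radius_weight_ge_half[OF that] by linarith
    have 1: "1 \<in> {1..m-1}" using m by auto
    \<comment> \<open>At \<open>t = 1\<close> the summand \<open>k = 1\<close> alone already reaches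
      1/2.\<close>
    have "(\<lambda>k. cos (pi / (real ((m - 1) div k) + 2))) 1 \<le> radius_poly m 1"
      unfolding radius_poly_def power_one mult_1
      by (rule member_le_sum[OF 1 nonneg]) auto
    with radius_weight_ge_half[OF 1] show ?thesis by simp
  qed
  ultimately obtain t where t: "0 \<le> t" "t \<le> 1" "radius_poly m t = 1/2"
    using IVT'[of "radius_poly m" 0 "1/2" 1] by auto
  have "t \<noteq> 0" using t \<open>radius_poly m 0 = 0\<close> by auto
  with t have t0: "0 < t" by simp
  have uniq: "s = t" if "0 < s \<and> radius_eq m s" for s
    using radius_poly_strict_mono[OF m, of s t] radius_poly_strict_mono[OF m, of t s] that t
    by (cases s t rule: linorder_cases) (auto simp: radius_eq_iff)
  have root: "0 < t \<and> radius_eq m t"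
    using t t0 by (simp add: radius_eq_iff)
  show "\<exists>!t. 0 < t \<and> radius_eq m t"
    using root uniq by (rule ex1I)
  have "radius m = t"
    unfolding radius_def using root uniq by (rule the_equality)
  then show "radius m \<in> {0<..1}" "radius_poly m (radius m) = 1/2"
    using t t0 by auto
qed

lemma radius_less_iff:
  assumes "2 \<le> m" "0 < t"
  shows "radius m < t \<longleftrightarrow> 1/2 < radius_poly m t"
  using radius_poly_strict_mono[OF assms(1), of t "radius m"]
    radius_poly_strict_mono[OF assms(1), of "radius m" t] ex1_radius[OF assms(1)] assms
  by (cases t "radius m" rule: linorder_cases) auto

section \<open>Monotonicity and limit of the radii\<close>

lemma radius_poly_Suc_greater:
  assumes m: "2 \<le> m" and t: "0 < t"
  shows "radius_poly m t < radius_poly (Suc m) t"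
proof -
  \<comment> \<open>Raising \<open>m\<close> can only increase the integer parts, hence the weights,
    and it adds a positive summand of degree \<open>m\<close>.\<close>
  have "radius_poly m t \<le> (\<Sum>k=1..m-1. t ^ k * cos (pi / (real (m div k) + 2)))"
    unfolding radius_poly_def
    using t by (intro sum_mono mult_left_mono cos_pi_div_mono) (auto simp: div_le_mono)
  also have "\<dots> < (\<Sum>k=1..m-1. t ^ k * cos (pi / (real (m div k) + 2))) + t ^ m * cos (pi / (real (m div m) + 2))"
    using radius_weight_ge_half[of m "Suc m"] m t by (auto intro!: mult_pos_pos)
  also have "\<dots> = radius_poly (Suc m) t"
    using m by (cases m) (auto simp: radius_poly_def)
  finally show ?thesis .
qed

lemma radius_Suc_less:
  assumes m: "2 \<le> m"
  shows "radius (Suc m) < radius m"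
  using radius_poly_Suc_greater[OF m, of "radius m"] ex1_radius[OF m] m
  by (subst radius_less_iff) auto

lemma strict_antimono_radius: "strict_antimono_on {2..} radius"
proof (rule monotone_onI)
  fix m m' :: nat
  assume "m \<in> {2..}" "m < m'"
  from this(2,1) show "radius m' < radius m"
    by (induction rule: less_Suc_induct) (auto intro: radius_Suc_less less_trans)
qed

text \<open>The weights are at most 1, and the full geometric series at 1/3 sums to exactly
  1/2.\<close>

lemma third_le_radius:
  assumes m: "2 \<le> m"
  shows "1/3 \<le> radius m"
proof (rule ccontr)
  assume "\<not> 1/3 \<le> radius m"
  then have "1/2 < radius_poly m (1/3)"
    using radius_less_iff[OF m, of "1/3"] by simp
  also have "\<dots> \<le> (\<Sum>k=1..m-1. (1/3) ^ k)"
    unfolding radius_poly_def by (intro sum_mono) (simp add: mult_left_le)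
  also have "\<dots> = (1 - (1/3) ^ (m - 1)) / 2"
    unfolding sum_gp using m by (cases m) (simp_all add: field_simps)
  also have "\<dots> \<le> 1/2" by simp
  finally show False by simp
qed

text \<open>Beyond 1/3 the geometric series exceeds 1/2, so some partial sum of length
  \<open>K\<close> does. For fixed \<open>K\<close> its weights tend to 1 as \<open>m\<close> grows,
  and the terms of higher degree are nonnegative.\<close>

lemma radius_tendsto: "radius \<longlonglongrightarrow> 1/3"
proof (rule order_tendstoI)
  fix s :: real assume "s < 1/3"
  then show "\<forall>\<^sub>F m in sequentially. s < radius m"
    using third_le_radius by (intro eventually_sequentiallyI[of 2]) (meson less_le_trans)
next
  fix s :: real assume s: "1/3 < s"
  \<comment> \<open>The cap at 1/2 keeps the geometric series convergent.\<close>
  define u where "u = min s (1/2)"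
  have u: "1/3 < u" "u < 1" "u \<le> s" using s by (auto simp: u_def)
  have "(\<lambda>K. \<Sum>k<K. u * u ^ k) \<longlonglongrightarrow> u * (1 / (1 - u))"
    using sums_mult[OF geometric_sums[of u], of u] u by (simp add: sums_def)
  moreover have "1/2 < u * (1 / (1 - u))"
    using u by (simp add: field_simps)
  ultimately have "\<forall>\<^sub>F K in sequentially. 1/2 < (\<Sum>k<K. u * u ^ k)"
    by (rule order_tendstoD(1))
  then obtain K where "1/2 < (\<Sum>k<K. u * u ^ k)"
    using eventually_happens by fastforce
  also have "(\<Sum>k<K. u * u ^ k) = (\<Sum>k=1..K. u ^ k)"
    by (rule sum.reindex_bij_witness[of _ "\<lambda>k. k - 1" Suc]) auto
  finally have K: "1/2 < (\<Sum>k=1..K. u ^ k)" .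
  have cos1: "(\<lambda>m. cos (pi / (real ((m - 1) div k) + 2))) \<longlonglongrightarrow> 1" if "1 \<le> k" for k
  proof -
    have "filterlim (\<lambda>m. (m - 1) div k) at_top sequentially"
      unfolding filterlim_at_top
    proof
      fix Z
      show "\<forall>\<^sub>F m in sequentially. Z \<le> (m - 1) div k"
        using that by (intro eventually_sequentiallyI[of "Z * k + 1"]) (auto simp: less_eq_div_iff_mult_less_eq)
    qed
    then have "filterlim (\<lambda>m. real ((m - 1) div k)) at_top sequentially"
      by (rule filterlim_compose[OF filterlim_real_sequentially])
    then have "filterlim (\<lambda>m. 2 + real ((m - 1) div k)) at_top sequentially"
      by (rule filterlim_tendsto_add_at_top[OF tendsto_const])
    then have "filterlim (\<lambda>m. real ((m - 1) div k) + 2) at_infinity sequentially"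
      by (intro filterlim_at_top_imp_at_infinity) (simp add: add.commute)
    then have "(\<lambda>m. pi / (real ((m - 1) div k) + 2)) \<longlonglongrightarrow> 0"
      by (rule tendsto_divide_0[OF tendsto_const])
    then have "(\<lambda>m. cos (pi / (real ((m - 1) div k) + 2))) \<longlonglongrightarrow> cos 0"
      by (rule tendsto_cos)
    then show ?thesis by simp
  qed
  have "(\<lambda>m. \<Sum>k=1..K. u ^ k * cos (pi / (real ((m - 1) div k) + 2))) \<longlonglongrightarrow> (\<Sum>k=1..K. u ^ k * 1)"
    by (intro tendsto_intros cos1) simp
  then have "\<forall>\<^sub>F m in sequentially. 1/2 < (\<Sum>k=1..K. u ^ k * cos (pi / (real ((m - 1) div k) + 2)))"
    by (rule order_tendstoD(1)) (use K in simp)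
  \<comment> \<open>This puts \<open>{1..K}\<close> inside \<open>{1..m-1}\<close> and ensures
    \<open>2 \<le> m\<close>.\<close>
  moreover have "\<forall>\<^sub>F m in sequentially. K + 2 \<le> m"
    by (rule eventually_ge_at_top)
  ultimately show "\<forall>\<^sub>F m in sequentially. radius m < s"
  proof eventually_elim
    case (elim m)
    note elim(1)
    also have "(\<Sum>k=1..K. u ^ k * cos (pi / (real ((m - 1) div k) + 2))) \<le> radius_poly m u"
      unfolding radius_poly_def
    proof (rule sum_mono2)
      fix k assume "k \<in> {1..m - 1} - {1..K}"
      then have "1/2 \<le> cos (pi / (real ((m - 1) div k) + 2))"
        by (intro radius_weight_ge_half) simp
      then show "0 \<le> u ^ k * cos (pi / (real ((m - 1) div k) + 2))"
        using u by (intro mult_nonneg_nonneg) auto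
    qed (use elim in auto)
    finally have "radius m < u"
      using radius_less_iff[of m u] elim u by simp
    then show "radius m < s" using u by simp
  qed
qed


section \<open>The Bohr inequality\<close>

text \<open>The bounds add up to \<open>Re (a []) + 2 * (1 - Re (a [])) * (1/2) = 1\<close> by the
  equation for the radius. The abstract \<open>B\<close> covers operator norms and scalar sums
  alike.\<close>

lemma Bohr_sum_le:
  fixes a :: "'n::finite list \<Rightarrow> complex"
  assumes m: "2 \<le> m" and a0: "a [] \<in> \<real>\<^sub>\<ge>\<^sub>0"
    and le: "op_le (Re_op (\<Sum>\<alpha> | length \<alpha> \<le> m - 1. a \<alpha> *\<^sub>C op_word creation \<alpha>)) id_blinfun"
    and B: "\<And>k. B k \<le> radius m ^ k * L2_set (\<lambda>\<alpha>. cmod (a \<alpha>)) (words k)"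
  shows "(\<Sum>k=0..m-1. B k) \<le> 1"
proof -
  have pos: "0 \<le> radius m" using ex1_radius(2)[OF m] by simp
  have L0: "L2_set (\<lambda>\<alpha>. cmod (a \<alpha>)) (words 0) = Re (a [])"
    using a0 by (simp add: words_0 complex_nonneg_Reals_iff cmod_eq_Re)
  have B0: "B 0 \<le> Re (a [])"
    using B[of 0] by (simp only: L0 power_0 mult_1)
  have "(\<Sum>k=0..m-1. B k) = B 0 + (\<Sum>k=1..m-1. B k)"
    by (subst sum.atLeast_Suc_atMost) simp_all
  also have "\<dots> \<le> Re (a []) +
      (\<Sum>k=1..m-1. radius m ^ k * (2 * (1 - Re (a [])) * cos (pi / (real ((m - 1) div k) + 2))))"
    using pos by (intro add_mono B0 sum_mono order_trans[OF B] mult_left_mono coefficient_bound[OF le a0]) auto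
  also have "\<dots> = Re (a []) + 2 * (1 - Re (a [])) * radius_poly m (radius m)"
    by (simp add: radius_poly_def sum_distrib_left mult_ac)
  also have "\<dots> = 1" by (simp add: ex1_radius(3)[OF m] field_simps)
  finally show ?thesis .
qed

text \<open>Cauchy-Schwarz over the words of length \<open>k\<close>, on which the scalar words have
  Euclidean norm \<open>norm r ^ k\<close>.\<close>

lemma sum_scalar_word_le:
  fixes r :: "real ^ 'n"
  assumes "norm r \<le> t"
  shows "(\<Sum>\<alpha>\<in>words k. cmod (a \<alpha>) * scalar_word r \<alpha>) \<le> t ^ k * L2_set (\<lambda>\<alpha>. cmod (a \<alpha>)) (words k)"
proof -
  have "(\<Sum>\<alpha>\<in>words k. cmod (a \<alpha>) * scalar_word r \<alpha>) \<le> (\<Sum>\<alpha>\<in>words k. \<bar>cmod (a \<alpha>)\<bar> * \<bar>scalar_word r \<alpha>\<bar>)"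
    by (intro sum_mono) (auto intro: mult_left_mono)
  also have "\<dots> \<le> L2_set (\<lambda>\<alpha>. cmod (a \<alpha>)) (words k) * L2_set (scalar_word r) (words k)"
    by (rule L2_set_mult_ineq)
  also have "L2_set (scalar_word r) (words k) = norm r ^ k"
    by (simp add: L2_set_def sum_scalar_word_square)
  also have "L2_set (\<lambda>\<alpha>. cmod (a \<alpha>)) (words k) * norm r ^ k \<le> L2_set (\<lambda>\<alpha>. cmod (a \<alpha>)) (words k) * t ^ k"
    using assms by (intro mult_left_mono power_mono) auto
  finally show ?thesis by (simp add: mult.commute)
qed

theorem theorem1p1:
  shows "(\<forall>m\<ge>2. (\<exists>!t. 0 < t \<and> radius_eq m t) \<and> radius m \<in> {0<..1}) \<and>
    (\<forall>m\<ge>2. \<forall>a :: 'n::finite list \<Rightarrow> complex.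
       a [] \<in> \<real>\<^sub>\<ge>\<^sub>0 \<and>
       op_le (Re_op (\<Sum>\<alpha> | length \<alpha> \<le> m - 1. a \<alpha> *\<^sub>C op_word creation \<alpha>)) id_blinfun \<longrightarrow>
       (\<forall>T \<in> row_ball (radius m) :: ('n \<Rightarrow> 'k::chilbert_space \<Rightarrow>\<^sub>L 'k) set.
          (\<Sum>k=0..m-1. norm (\<Sum>\<alpha> | length \<alpha> = k. cmod (a \<alpha>) *\<^sub>R op_word T \<alpha>)) \<le> 1) \<and>
       (\<forall>r :: real ^ 'n. (\<forall>i. 0 \<le> r $ i) \<and> norm r \<le> radius m \<longrightarrow>
          (\<Sum>\<alpha> | length \<alpha> \<le> m - 1. cmod (a \<alpha>) * scalar_word r \<alpha>) \<le> 1)) \<and>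
    strict_antimono_on {2..} radius \<and>
    radius \<longlonglongrightarrow> 1/3"
proof (intro conjI allI impI ballI)
  fix m :: nat assume m: "2 \<le> m"
  show "\<exists>!t. 0 < t \<and> radius_eq m t" "radius m \<in> {0<..1}"
    using ex1_radius[OF m] by auto
next
  fix m :: nat and a :: "'n list \<Rightarrow> complex" and T :: "'n \<Rightarrow> 'k \<Rightarrow>\<^sub>L 'k"
  assume m: "2 \<le> m" and T: "T \<in> row_ball (radius m)"
    and a: "a [] \<in> \<real>\<^sub>\<ge>\<^sub>0 \<and>
      op_le (Re_op (\<Sum>\<alpha> | length \<alpha> \<le> m - 1. a \<alpha> *\<^sub>C op_word creation \<alpha>)) id_blinfun"
  have "0 \<le> radius m" using ex1_radius(2)[OF m] by simp
  then show "(\<Sum>k=0..m-1. norm (\<Sum>\<alpha> | length \<alpha> = k. cmod (a \<alpha>) *\<^sub>R op_word T \<alpha>)) \<le> 1"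
    using m a by (intro Bohr_sum_le[of m a] norm_word_combination_le[OF T]) auto
next
  fix m :: nat and a :: "'n list \<Rightarrow> complex" and r :: "real ^ 'n"
  assume m: "2 \<le> m" and r: "(\<forall>i. 0 \<le> r $ i) \<and> norm r \<le> radius m"
    and a: "a [] \<in> \<real>\<^sub>\<ge>\<^sub>0 \<and>
      op_le (Re_op (\<Sum>\<alpha> | length \<alpha> \<le> m - 1. a \<alpha> *\<^sub>C op_word creation \<alpha>)) id_blinfun"
  \<comment> \<open>Grouping the words by length makes the part of degree \<open>k\<close> the bound
    \<open>B k\<close>.\<close>
  show "(\<Sum>\<alpha> | length \<alpha> \<le> m - 1. cmod (a \<alpha>) * scalar_word r \<alpha>) \<le> 1"
    unfolding sum_words_le using m a r by (intro Bohr_sum_le[of m a] sum_scalar_word_le) auto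
qed (rule strict_antimono_radius radius_tendsto)+

end
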